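(* Let $G$ be a group and fix $g\in G$. Let $R$ and $S$ be $G$-rings, let $(P,\gamma)\colon R\to S$ be a left dualizable 1-cell in the bicategory of $G$-twists $\mathbf{Bimod}/\mathcal R\mathrm{ing}^{G\text{-tw}}$, and let $f\colon P\Rightarrow P$ be a 2-cell. Then, for every $s\in S$, $$\operatorname{tr}^g(f)([s])=\operatorname{tr}^g_{\mathrm{HS},\gamma}(f\circ\rho_s)=\operatorname{tr}^g_{\mathrm{HS},\gamma}(\rho_s\circ f)\ \in\ \mathrm{HH}^g_0(R),$$ where $\rho_s\colon P\to P$ denotes right multiplication by $s$.
   Context: **Base bicategory.** 0-cells: $G$-rings $(R,\alpha)$ (rings with a homomorphism $\alpha\colon G\to\mathrm{Aut}_{\mathrm{ring}}(R)$; write $g(r)=\alpha_g(r)$). 1-cells $R\to S$: $(R,S)$-bimodules. 2-cells: bimodule maps. Composition of $M\colon R\to S$ and $N\colon S\to T$: $M\odot N=M\otimes_SN\colon R\to T$; unit $U_R=R$. Let $\Theta_R(g)=R^g$ be $R$ with the usual left action and right action twisted by $\alpha_g$; there are canonical isomorphisms $R^g\otimes_RR^h\cong R^{gh}$, $R\cong R^e$. Put ${}^gM=\Theta_R(g^{-1})\odot M$, canonically identified with the group $M$ with left action $r\cdot m=g(r)m$ and unchanged right action, and $M^g=M\odot\Theta_S(g)$, identified with $M$ with right action $m\cdot s=m\,g(s)$. **Bicategory of $G$-twists $\mathbf{Bimod}/\mathcal R\mathrm{ing}^{G\text{-tw}}$.** Same 0-cells. A 1-cell $R\to S$ is $(M,\tau)$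 with $M$ an $(R,S)$-bimodule and bimodule isomorphisms $\tau_g\colon\Theta_R(g)\odot M\to M\odot\Theta_S(g)$ ($g\in G$) with $\tau_e$ canonical and $\tau_{gh}=(\tau_g\odot\mathrm{id})(\mathrm{id}\odot\tau_h)$ after the canonical identifications $\Theta(gh)\cong\Theta(g)\odot\Theta(h)$. 2-cells are bimodule maps $f$ commuting with the $\tau_g$'s. Composites carry $(\mathrm{id}\odot\sigma_g)(\tau_g\odot\mathrm{id})$; the unit $R$ carries the canonical constraints. The bi-twist isomorphism $\gamma_g\colon M\xrightarrow{\cong}{}^gM^g=\Theta_R(g^{-1})\odot M\odot\Theta_S(g)$ corresponding to $\tau_g$ is $M\cong\Theta_R(g^{-1})\odot\Theta_R(g)\odot M\xrightarrow{\mathrm{id}\odot\tau_g}{}^gM^g$; the family $\gamma=(\gamma_g)$ is equivalent to $\tau$, so one writes $(M,\gamma)$. (Equivalently, $\gamma$ is an action $\phi$ of $G$ on the group $M$ with $\phi_g(rms)=g(r)\phi_g(m)g(s)$.) The transport map is $g_M=(\tau_{g^{-1}})^{-1}\colon M^{g^{-1}}\to{}^gM$. **Twisted shadow.** The ordinary shadow is $\langle\!\langle M\rangle\!\rangle_R=\mathrm{HH}_0(R;M)=M/\langle rm-mr\rangle$ with cyclicity $\theta[m\otimes n]=[n\otimes m]$. The $g$-twisted shadow is ${}^g\langle\!\langle M\rangle\!\rangle_R=\mathrm{HH}_0(R;{}^gM)=\mathrm{HH}^g_0(R;M)=M/\langle g(r)m-mr\rangle$; write $\mathrm{HH}^g_0(R)=\mathrm{HH}^g_0(R;R)$,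 and $[m]$ for classes. Twisted cyclicity ${}^g\theta_{M,N}$ is the composite $\langle\!\langle{}^gM\odot N\rangle\!\rangle_R\xrightarrow{\theta}\langle\!\langle N\odot{}^gM\rangle\!\rangle_S\cong\langle\!\langle N^{g^{-1}}\odot M\rangle\!\rangle_S\xrightarrow{g_N\odot\mathrm{id}}\langle\!\langle{}^gN\odot M\rangle\!\rangle_S$ for $M\colon R\to S$, $N\colon S\to R$. **Twisted trace.** $P\colon R\to S$ is left dualizable if there are a 1-cell ${}^*P\colon S\to R$ and 2-cells $\bar\eta\colon U_S\Rightarrow{}^*P\odot P$, $\bar\epsilon\colon P\odot{}^*P\Rightarrow U_R$ satisfying the triangle identities (equivalently here, $P$ is finitely generated projective as a left $R$-module). For a 2-cell $f\colon P\Rightarrow P$, $\operatorname{tr}^g(f)\colon\mathrm{HH}^g_0(S)\to\mathrm{HH}^g_0(R)$ is the composite ${}^g\langle\!\langle U_S\rangle\!\rangle\xrightarrow{\bar\eta}{}^g\langle\!\langle{}^*P\odot P\rangle\!\rangle\xrightarrow{\mathrm{id}\odot f}{}^g\langle\!\langle{}^*P\odot P\rangle\!\rangle\xrightarrow{{}^g\theta}{}^g\langle\!\langle P\odot{}^*P\rangle\!\rangle\xrightarrow{\bar\epsilon}{}^g\langle\!\langle U_R\rangle\!\rangle$. **Twisted Hattori–Stallings trace.** For $P$ a finitely generated projective left $R$-module with ${}^*P=\mathrm{Hom}_R(P,R)$, let $\delta\colon{}^*P\otimes_R{}^gP\xrightarrow{\cong}\mathrm{Hom}_R(P,{}^gP)$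 be the canonical isomorphism and $\pi^{(g)}\colon{}^*P\otimes_R{}^gP\to\mathrm{HH}^g_0(R)$, $\xi\otimes p\mapsto[\xi(p)]$. Put $\operatorname{tr}^g_{\mathrm{HS}}(\psi)=\pi^{(g)}(\delta^{-1}(\psi))$ for a left $R$-linear $\psi\colon P\to{}^gP$. For a left $R$-linear endomorphism $h\colon P\to P$, $\operatorname{tr}^g_{\mathrm{HS},\gamma}(h)=\operatorname{tr}^g_{\mathrm{HS}}(\gamma_g\circ h)$, where $\gamma_g$ is regarded as a left $R$-module isomorphism $P\to{}^gP$ by forgetting the right $S$-structure. *)

theory Defs
  imports "HOL-Algebra.Free_Abelian_Groups" "HOL-Algebra.Generated_Groups"
    "HOL-Algebra.Bij" "HOL-Algebra.Ring"
begin

section \<open>Rings with a group action\<close>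

record ('g, 'r) gring = "'r ring" +
  act :: "'g \<Rightarrow> 'r \<Rightarrow> 'r"

definition AutoRing :: "('r, 'x) ring_scheme \<Rightarrow> ('r \<Rightarrow> 'r) monoid" where
  "AutoRing R = BijGroup (carrier R) \<lparr>carrier := ring_hom R R \<inter> Bij (carrier R)\<rparr>"

locale G_ring = group G + R: ring R
  for G :: "('g, 'y) monoid_scheme" and R :: "('g, 'r) gring" +
  assumes act_hom: "act R \<in> hom G (AutoRing R)"


section \<open>Bimodules\<close>

text \<open>The additive group of a bimodule is a commutative group in the (multiplicative) notation of
  HOL-Algebra's quotient groups and free Abelian groups: \<open>\<otimes>\<^bsub>M\<^esub>\<close>, \<open>\<one>\<^bsub>M\<^esub>\<close> and \<open>inv\<^bsub>M\<^esub>\<close> are addition,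
  zero and negation of \<open>M\<close>.\<close>

record ('r, 's, 'm) bimod = "'m monoid" +
  lact :: "'r \<Rightarrow> 'm \<Rightarrow> 'm"
  ract :: "'m \<Rightarrow> 's \<Rightarrow> 'm"

locale bimodule = R: ring R + S: ring S + M: comm_group M
  for R :: "('r, 'x) ring_scheme" and S :: "('s, 'y) ring_scheme" and M :: "('r, 's, 'm) bimod" +
  assumes lact_closed: "r \<in> carrier R \<Longrightarrow> m \<in> carrier M \<Longrightarrow> lact M r m \<in> carrier M"
    and ract_closed: "m \<in> carrier M \<Longrightarrow> s \<in> carrier S \<Longrightarrow> ract M m s \<in> carrier M"
    and lact_add: "r \<in> carrier R \<Longrightarrow> m \<in> carrier M \<Longrightarrow> n \<in> carrier M \<Longrightarrow>
          lact M r (m \<otimes>\<^bsub>M\<^esub> n) = lact M r m \<otimes>\<^bsub>M\<^esub> lact M r n"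
    and ract_add: "s \<in> carrier S \<Longrightarrow> m \<in> carrier M \<Longrightarrow> n \<in> carrier M \<Longrightarrow>
          ract M (m \<otimes>\<^bsub>M\<^esub> n) s = ract M m s \<otimes>\<^bsub>M\<^esub> ract M n s"
    and add_lact: "r \<in> carrier R \<Longrightarrow> r' \<in> carrier R \<Longrightarrow> m \<in> carrier M \<Longrightarrow>
          lact M (r \<oplus>\<^bsub>R\<^esub> r') m = lact M r m \<otimes>\<^bsub>M\<^esub> lact M r' m"
    and add_ract: "s \<in> carrier S \<Longrightarrow> s' \<in> carrier S \<Longrightarrow> m \<in> carrier M \<Longrightarrow>
          ract M m (s \<oplus>\<^bsub>S\<^esub> s') = ract M m s \<otimes>\<^bsub>M\<^esub> ract M m s'"
    and mult_lact: "r \<in> carrier R \<Longrightarrow> r' \<in> carrier R \<Longrightarrow> m \<in> carrier M \<Longrightarrow>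
          lact M (r \<otimes>\<^bsub>R\<^esub> r') m = lact M r (lact M r' m)"
    and mult_ract: "s \<in> carrier S \<Longrightarrow> s' \<in> carrier S \<Longrightarrow> m \<in> carrier M \<Longrightarrow>
          ract M m (s \<otimes>\<^bsub>S\<^esub> s') = ract M (ract M m s) s'"
    and one_lact: "m \<in> carrier M \<Longrightarrow> lact M \<one>\<^bsub>R\<^esub> m = m"
    and one_ract: "m \<in> carrier M \<Longrightarrow> ract M m \<one>\<^bsub>S\<^esub> = m"
    and lact_ract: "r \<in> carrier R \<Longrightarrow> s \<in> carrier S \<Longrightarrow> m \<in> carrier M \<Longrightarrow>
          ract M (lact M r m) s = lact M r (ract M m s)"

definition bimod_hom :: "('r, 'x) ring_scheme \<Rightarrow> ('s, 'y) ring_scheme \<Rightarrow> ('r, 's, 'm) bimod \<Rightarrow>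
    ('r, 's, 'n) bimod \<Rightarrow> ('m \<Rightarrow> 'n) set" where
  "bimod_hom R S M N = {f \<in> hom M N.
     (\<forall>r \<in> carrier R. \<forall>m \<in> carrier M. f (lact M r m) = lact N r (f m)) \<and>
     (\<forall>s \<in> carrier S. \<forall>m \<in> carrier M. f (ract M m s) = ract N (f m) s)}"

definition bimod_iso :: "('r, 'x) ring_scheme \<Rightarrow> ('s, 'y) ring_scheme \<Rightarrow> ('r, 's, 'm) bimod \<Rightarrow>
    ('r, 's, 'n) bimod \<Rightarrow> ('m \<Rightarrow> 'n) set" where
  "bimod_iso R S M N = {f \<in> bimod_hom R S M N. bij_betw f (carrier M) (carrier N)}"

definition unit_bimod :: "('r, 'x) ring_scheme \<Rightarrow> ('r, 'r, 'r) bimod" where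
  "unit_bimod R = \<lparr>carrier = carrier R, monoid.mult = (\<oplus>\<^bsub>R\<^esub>), one = \<zero>\<^bsub>R\<^esub>,
     lact = (\<otimes>\<^bsub>R\<^esub>), ract = (\<otimes>\<^bsub>R\<^esub>)\<rparr>"


section \<open>Tensor products\<close>

type_synonym ('m, 'n) tens = "('m \<times> 'n \<Rightarrow>\<^sub>0 int) set"

definition tensor_rel :: "('s, 'x) ring_scheme \<Rightarrow> ('r, 's, 'm) bimod \<Rightarrow> ('s, 't, 'n) bimod \<Rightarrow>
    ('m \<times> 'n \<Rightarrow>\<^sub>0 int) set" where
  "tensor_rel S M N =
     {frag_of (m \<otimes>\<^bsub>M\<^esub> m', n) - frag_of (m, n) - frag_of (m', n) | m m' n.
        m \<in> carrier M \<and> m' \<in> carrier M \<and> n \<in> carrier N} \<union>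
     {frag_of (m, n \<otimes>\<^bsub>N\<^esub> n') - frag_of (m, n) - frag_of (m, n') | m n n'.
        m \<in> carrier M \<and> n \<in> carrier N \<and> n' \<in> carrier N} \<union>
     {frag_of (ract M m s, n) - frag_of (m, lact N s n) | m s n.
        m \<in> carrier M \<and> s \<in> carrier S \<and> n \<in> carrier N}"

definition tensor_ker :: "('s, 'x) ring_scheme \<Rightarrow> ('r, 's, 'm) bimod \<Rightarrow> ('s, 't, 'n) bimod \<Rightarrow>
    ('m, 'n) tens" where
  "tensor_ker S M N =
     generate (free_Abelian_group (carrier M \<times> carrier N)) (tensor_rel S M N)"

definition tensor_group :: "('s, 'x) ring_scheme \<Rightarrow> ('r, 's, 'm) bimod \<Rightarrow> ('s, 't, 'n) bimod \<Rightarrow>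
    ('m, 'n) tens monoid" where
  "tensor_group S M N = free_Abelian_group (carrier M \<times> carrier N) Mod tensor_ker S M N"

text \<open>The pure tensor \<open>m \<otimes> n\<close>.\<close>

definition pure_tensor :: "('s, 'x) ring_scheme \<Rightarrow> ('r, 's, 'm) bimod \<Rightarrow> ('s, 't, 'n) bimod \<Rightarrow>
    'm \<Rightarrow> 'n \<Rightarrow> ('m, 'n) tens" where
  "pure_tensor S M N m n =
     tensor_ker S M N #>\<^bsub>free_Abelian_group (carrier M \<times> carrier N)\<^esub> frag_of (m, n)"

text \<open>The homomorphism from a tensor product to the commutative group \<open>A\<close> that is given on pure
  tensors by \<open>m \<otimes> n \<mapsto> \<beta> m n\<close>, for a biadditive and balanced map \<open>\<beta>\<close>.\<close>

definition tensor_lift :: "('a, 'x) monoid_scheme \<Rightarrow> ('m \<Rightarrow> 'n \<Rightarrow> 'a) \<Rightarrow> ('m, 'n) tens \<Rightarrow> 'a" where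
  "tensor_lift A \<beta> X = the_elem
     ((\<lambda>c. finprod A (\<lambda>(m, n). \<beta> m n [^]\<^bsub>A\<^esub> Poly_Mapping.lookup c (m, n)) (Poly_Mapping.keys c)) ` X)"

definition tensor :: "('s, 'x) ring_scheme \<Rightarrow> ('r, 's, 'm) bimod \<Rightarrow> ('s, 't, 'n) bimod \<Rightarrow>
    ('r, 't, ('m, 'n) tens) bimod" where
  "tensor S M N = \<lparr>carrier = carrier (tensor_group S M N),
     monoid.mult = monoid.mult (tensor_group S M N), one = one (tensor_group S M N),
     lact = (\<lambda>r. tensor_lift (tensor_group S M N) (\<lambda>m n. pure_tensor S M N (lact M r m) n)),
     ract = (\<lambda>x t. tensor_lift (tensor_group S M N) (\<lambda>m n. pure_tensor S M N m (ract N n t)) x)\<rparr>"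

text \<open>\<open>tensor_map S M' N' f h\<close> is \<open>f \<odot> h\<close>, with target \<open>M' \<odot> N'\<close>.\<close>

definition tensor_map :: "('s, 'x) ring_scheme \<Rightarrow> ('r, 's, 'm1) bimod \<Rightarrow> ('s, 't, 'n1) bimod \<Rightarrow>
    ('m \<Rightarrow> 'm1) \<Rightarrow> ('n \<Rightarrow> 'n1) \<Rightarrow> ('m, 'n) tens \<Rightarrow> ('m1, 'n1) tens" where
  "tensor_map S M' N' f h = tensor_lift (tensor S M' N') (\<lambda>m n. pure_tensor S M' N' (f m) (h n))"

text \<open>The associators \<open>(L \<odot> M) \<odot> N \<rightarrow> L \<odot> (M \<odot> N)\<close> and back, for \<open>L \<odot> M\<close> formed over \<open>S\<close> and
  \<open>M \<odot> N\<close> formed over \<open>T\<close>, and the unitors and their inverses.\<close>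

definition assoc_r :: "('s, 'x) ring_scheme \<Rightarrow> ('t, 'y) ring_scheme \<Rightarrow> ('r, 's, 'l) bimod \<Rightarrow>
    ('s, 't, 'm) bimod \<Rightarrow> ('t, 'u, 'n) bimod \<Rightarrow>
    (('l, 'm) tens, 'n) tens \<Rightarrow> ('l, ('m, 'n) tens) tens" where
  "assoc_r S T L M N =
     tensor_lift (tensor S L (tensor T M N)) (\<lambda>x n.
       tensor_lift (tensor S L (tensor T M N)) (\<lambda>l m.
         pure_tensor S L (tensor T M N) l (pure_tensor T M N m n)) x)"

definition assoc_l :: "('s, 'x) ring_scheme \<Rightarrow> ('t, 'y) ring_scheme \<Rightarrow> ('r, 's, 'l) bimod \<Rightarrow>
    ('s, 't, 'm) bimod \<Rightarrow> ('t, 'u, 'n) bimod \<Rightarrow>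
    ('l, ('m, 'n) tens) tens \<Rightarrow> (('l, 'm) tens, 'n) tens" where
  "assoc_l S T L M N =
     tensor_lift (tensor T (tensor S L M) N) (\<lambda>l y.
       tensor_lift (tensor T (tensor S L M) N) (\<lambda>m n.
         pure_tensor T (tensor S L M) N (pure_tensor S L M l m) n) y)"

definition lunit :: "('r, 's, 'm) bimod \<Rightarrow> ('r, 'm) tens \<Rightarrow> 'm" where
  "lunit M = tensor_lift M (lact M)"

definition lunit_inv :: "('r, 'x) ring_scheme \<Rightarrow> ('r, 's, 'm) bimod \<Rightarrow> 'm \<Rightarrow> ('r, 'm) tens" where
  "lunit_inv R M m = pure_tensor R (unit_bimod R) M \<one>\<^bsub>R\<^esub> m"

definition runit :: "('r, 's, 'm) bimod \<Rightarrow> ('m, 's) tens \<Rightarrow> 'm" where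
  "runit M = tensor_lift M (ract M)"

definition runit_inv :: "('s, 'x) ring_scheme \<Rightarrow> ('r, 's, 'm) bimod \<Rightarrow> 'm \<Rightarrow> ('m, 's) tens" where
  "runit_inv S M m = pure_tensor S M (unit_bimod S) m \<one>\<^bsub>S\<^esub>"


section \<open>Twisting by the group action\<close>

text \<open>\<open>ltwist R g M\<close> and \<open>rtwist S g M\<close> are \<open>\<^sup>gM\<close> and \<open>M\<^sup>g\<close>, realised on the group \<open>M\<close>. With the
  tensor product above, \<open>ltwist R g (tensor S M N)\<close> and \<open>tensor S (ltwist R g M) N\<close> are the same.\<close>

definition ltwist :: "('g, 'r) gring \<Rightarrow> 'g \<Rightarrow> ('r, 's, 'm) bimod \<Rightarrow> ('r, 's, 'm) bimod" where
  "ltwist R g M = M\<lparr>lact := \<lambda>r m. lact M (act R g r) m\<rparr>"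

definition rtwist :: "('g, 's) gring \<Rightarrow> 'g \<Rightarrow> ('r, 's, 'm) bimod \<Rightarrow> ('r, 's, 'm) bimod" where
  "rtwist S g M = M\<lparr>ract := \<lambda>m s. ract M m (act S g s)\<rparr>"

definition Theta :: "('g, 'r) gring \<Rightarrow> 'g \<Rightarrow> ('r, 'r, 'r) bimod" where
  "Theta R g = rtwist R g (unit_bimod R)"

text \<open>The canonical isomorphisms \<open>\<Theta>(g) \<odot> \<Theta>(h) \<rightarrow> \<Theta>(gh)\<close>, \<open>x \<otimes> y \<mapsto> x g(y)\<close>;
  \<open>\<Theta>\<^sub>R(g\<inverse>) \<odot> M \<rightarrow> \<^sup>gM\<close>, \<open>x \<otimes> m \<mapsto> g(x) m\<close>; and \<open>M \<odot> \<Theta>\<^sub>S(g) \<rightarrow> M\<^sup>g\<close>, \<open>m \<otimes> x \<mapsto> m x\<close>, with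
  inverse \<open>m \<mapsto> m \<otimes> 1\<close>.\<close>

definition Theta_mult :: "('g, 'r) gring \<Rightarrow> 'g \<Rightarrow> ('r, 'r) tens \<Rightarrow> 'r" where
  "Theta_mult R g = tensor_lift (add_monoid R) (\<lambda>x y. x \<otimes>\<^bsub>R\<^esub> act R g y)"

definition ltwist_can :: "('g, 'r) gring \<Rightarrow> 'g \<Rightarrow> ('r, 's, 'm) bimod \<Rightarrow> ('r, 'm) tens \<Rightarrow> 'm" where
  "ltwist_can R g M = tensor_lift M (\<lambda>x m. lact M (act R g x) m)"

definition rtwist_can :: "('r, 's, 'm) bimod \<Rightarrow> ('m, 's) tens \<Rightarrow> 'm" where
  "rtwist_can M = tensor_lift M (ract M)"

definition rtwist_can_inv :: "('g, 's) gring \<Rightarrow> 'g \<Rightarrow> ('r, 's, 'm) bimod \<Rightarrow> 'm \<Rightarrow> ('m, 's) tens" where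
  "rtwist_can_inv S g M m = pure_tensor S M (Theta S g) m \<one>\<^bsub>S\<^esub>"


section \<open>The bicategory of twists\<close>

text \<open>A constraint on \<open>M\<close> is a family \<open>\<tau> g : \<Theta>\<^sub>R(g) \<odot> M \<rightarrow> M \<odot> \<Theta>\<^sub>S(g)\<close>.\<close>

type_synonym ('g, 'r, 's, 'm) twist = "'g \<Rightarrow> ('r, 'm) tens \<Rightarrow> ('m, 's) tens"

text \<open>In the unit axiom \<open>\<Theta>(\<one>)\<close> and the unit bimodule agree on carriers, so the canonical map is
  \<open>x \<otimes> m \<mapsto> x m \<mapsto> x m \<otimes> 1\<close>. The multiplicativity axiom is stated on \<open>\<Theta>(g) \<odot> (\<Theta>(h) \<odot> M)\<close>.\<close>

definition twist_1cell :: "('g, 'y) monoid_scheme \<Rightarrow> ('g, 'r) gring \<Rightarrow> ('g, 's) gring \<Rightarrow>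
    ('r, 's, 'm) bimod \<Rightarrow> ('g, 'r, 's, 'm) twist \<Rightarrow> bool" where
  "twist_1cell G R S M \<tau> \<longleftrightarrow> bimodule R S M \<and>
     (\<forall>g \<in> carrier G. \<tau> g \<in> bimod_iso R S (tensor R (Theta R g) M) (tensor S M (Theta S g))) \<and>
     (\<forall>x \<in> carrier (tensor R (Theta R \<one>\<^bsub>G\<^esub>) M). \<tau> \<one>\<^bsub>G\<^esub> x = rtwist_can_inv S \<one>\<^bsub>G\<^esub> M (lunit M x)) \<and>
     (\<forall>g \<in> carrier G. \<forall>h \<in> carrier G.
        \<forall>x \<in> carrier (tensor R (Theta R g) (tensor R (Theta R h) M)).
          \<tau> (g \<otimes>\<^bsub>G\<^esub> h)
            (tensor_map R (Theta R (g \<otimes>\<^bsub>G\<^esub> h)) M (Theta_mult R g) (\<lambda>m. m)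
              (assoc_l R R (Theta R g) (Theta R h) M x)) =
          tensor_map S M (Theta S (g \<otimes>\<^bsub>G\<^esub> h)) (\<lambda>m. m) (Theta_mult S g)
            (assoc_r S S M (Theta S g) (Theta S h)
              (tensor_map S (tensor S M (Theta S g)) (Theta S h) (\<tau> g) (\<lambda>y. y)
                (assoc_l R S (Theta R g) M (Theta S h)
                  (tensor_map R (Theta R g) (tensor S M (Theta S h)) (\<lambda>y. y) (\<tau> h) x)))))"

definition twist_2cell :: "('g, 'y) monoid_scheme \<Rightarrow> ('g, 'r) gring \<Rightarrow> ('g, 's) gring \<Rightarrow>
    ('r, 's, 'm) bimod \<Rightarrow> ('g, 'r, 's, 'm) twist \<Rightarrow> ('r, 's, 'n) bimod \<Rightarrow> ('g, 'r, 's, 'n) twist \<Rightarrow>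
    ('m \<Rightarrow> 'n) \<Rightarrow> bool" where
  "twist_2cell G R S M \<tau> N \<nu> f \<longleftrightarrow> f \<in> bimod_hom R S M N \<and>
     (\<forall>g \<in> carrier G. \<forall>x \<in> carrier (tensor R (Theta R g) M).
        \<nu> g (tensor_map R (Theta R g) N (\<lambda>y. y) f x) =
        tensor_map S N (Theta S g) f (\<lambda>y. y) (\<tau> g x))"

definition unit_twist :: "('g, 'r) gring \<Rightarrow> ('g, 'r, 'r, 'r) twist" where
  "unit_twist R g x = lunit_inv R (Theta R g) (runit (Theta R g) x)"

text \<open>The constraint on \<open>M \<odot> N\<close> for \<open>(M, \<tau>) : R \<rightarrow> S\<close> and \<open>(N, \<sigma>) : S \<rightarrow> T\<close>.\<close>

definition comp_twist :: "('g, 'r) gring \<Rightarrow> ('g, 's) gring \<Rightarrow> ('g, 't) gring \<Rightarrow>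
    ('r, 's, 'm) bimod \<Rightarrow> ('g, 'r, 's, 'm) twist \<Rightarrow> ('s, 't, 'n) bimod \<Rightarrow> ('g, 's, 't, 'n) twist \<Rightarrow>
    ('g, 'r, 't, ('m, 'n) tens) twist" where
  "comp_twist R S T M \<tau> N \<sigma> g x =
     assoc_l S T M N (Theta T g)
       (tensor_map S M (tensor T N (Theta T g)) (\<lambda>m. m) (\<sigma> g)
         (assoc_r S S M (Theta S g) N
           (tensor_map S (tensor S M (Theta S g)) N (\<tau> g) (\<lambda>n. n)
             (assoc_l R S (Theta R g) M N x))))"

text \<open>\<open>(D, \<sigma>)\<close> is a left dual of \<open>(P, \<tau>)\<close> with coevaluation \<open>\<eta> : U\<^sub>S \<Rightarrow> D \<odot> P\<close> and evaluation
  \<open>\<epsilon> : P \<odot> D \<Rightarrow> U\<^sub>R\<close>.\<close>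

definition left_dual :: "('g, 'y) monoid_scheme \<Rightarrow> ('g, 'r) gring \<Rightarrow> ('g, 's) gring \<Rightarrow>
    ('r, 's, 'p) bimod \<Rightarrow> ('g, 'r, 's, 'p) twist \<Rightarrow> ('s, 'r, 'd) bimod \<Rightarrow> ('g, 's, 'r, 'd) twist \<Rightarrow>
    ('s \<Rightarrow> ('d, 'p) tens) \<Rightarrow> (('p, 'd) tens \<Rightarrow> 'r) \<Rightarrow> bool" where
  "left_dual G R S P \<tau> D \<sigma> \<eta> \<epsilon> \<longleftrightarrow> twist_1cell G S R D \<sigma> \<and>
     twist_2cell G S S (unit_bimod S) (unit_twist S) (tensor R D P) (comp_twist S R S D \<sigma> P \<tau>) \<eta> \<and>
     twist_2cell G R R (tensor S P D) (comp_twist R S R P \<tau> D \<sigma>) (unit_bimod R) (unit_twist R) \<epsilon> \<and>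
     (\<forall>p \<in> carrier P.
        lunit P (tensor_map R (unit_bimod R) P \<epsilon> (\<lambda>q. q)
          (assoc_l S R P D P
            (tensor_map S P (tensor R D P) (\<lambda>q. q) \<eta> (runit_inv S P p)))) = p) \<and>
     (\<forall>d \<in> carrier D.
        runit D (tensor_map R D (unit_bimod R) (\<lambda>c. c) \<epsilon>
          (assoc_r R S D P D
            (tensor_map S (tensor R D P) D \<eta> (\<lambda>c. c) (lunit_inv S D d)))) = d)"

text \<open>\<open>\<gamma>\<^sub>g : M \<rightarrow> \<^sup>gM\<^sup>g\<close>, where \<open>m \<mapsto> 1 \<otimes> (1 \<otimes> m)\<close> is the canonical
  \<open>M \<cong> \<Theta>\<^sub>R(g\<inverse>) \<odot> (\<Theta>\<^sub>R(g) \<odot> M)\<close> and \<open>\<Theta>\<^sub>R(g\<inverse>) \<odot> (M \<odot> \<Theta>\<^sub>S(g))\<close> is identified with the group \<open>M\<close>.\<close>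

definition bitwist :: "('g, 'y) monoid_scheme \<Rightarrow> ('g, 'r) gring \<Rightarrow> ('g, 's) gring \<Rightarrow>
    ('r, 's, 'm) bimod \<Rightarrow> ('g, 'r, 's, 'm) twist \<Rightarrow> 'g \<Rightarrow> 'm \<Rightarrow> 'm" where
  "bitwist G R S M \<tau> g m =
     rtwist_can M
       (ltwist_can R g (tensor S M (Theta S g))
         (tensor_map R (Theta R (inv\<^bsub>G\<^esub> g)) (tensor S M (Theta S g)) (\<lambda>x. x) (\<tau> g)
           (pure_tensor R (Theta R (inv\<^bsub>G\<^esub> g)) (tensor R (Theta R g) M) \<one>\<^bsub>R\<^esub>
             (pure_tensor R (Theta R g) M \<one>\<^bsub>R\<^esub> m))))"

text \<open>The transport map from \<open>M\<^bsup>g\<inverse>\<^esup>\<close> to \<open>\<^sup>gM\<close>, both realised on the group \<open>M\<close>.\<close>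

definition transport :: "('g, 'y) monoid_scheme \<Rightarrow> ('g, 'r) gring \<Rightarrow> ('g, 's) gring \<Rightarrow>
    ('r, 's, 'm) bimod \<Rightarrow> ('g, 'r, 's, 'm) twist \<Rightarrow> 'g \<Rightarrow> 'm \<Rightarrow> 'm" where
  "transport G R S M \<tau> g m =
     ltwist_can R g M
       (inv_into (carrier (tensor R (Theta R (inv\<^bsub>G\<^esub> g)) M)) (\<tau> (inv\<^bsub>G\<^esub> g))
         (rtwist_can_inv S (inv\<^bsub>G\<^esub> g) M m))"


section \<open>Shadows\<close>

definition HH0_ker :: "('r, 'x) ring_scheme \<Rightarrow> ('r, 'r, 'm) bimod \<Rightarrow> 'm set" where
  "HH0_ker R M = generate M {lact M r m \<otimes>\<^bsub>M\<^esub> inv\<^bsub>M\<^esub> (ract M m r) | r m. r \<in> carrier R \<and> m \<in> carrier M}"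

definition HH0 :: "('r, 'x) ring_scheme \<Rightarrow> ('r, 'r, 'm) bimod \<Rightarrow> 'm set monoid" where
  "HH0 R M = M Mod HH0_ker R M"

definition HH0_class :: "('r, 'x) ring_scheme \<Rightarrow> ('r, 'r, 'm) bimod \<Rightarrow> 'm \<Rightarrow> 'm set" where
  "HH0_class R M m = HH0_ker R M #>\<^bsub>M\<^esub> m"

text \<open>\<open>HH0_map R N f\<close> is the map induced by \<open>f\<close> with target \<open>HH0 R N\<close>.\<close>

definition HH0_map :: "('r, 'x) ring_scheme \<Rightarrow> ('r, 'r, 'n) bimod \<Rightarrow> ('m \<Rightarrow> 'n) \<Rightarrow> 'm set \<Rightarrow> 'n set" where
  "HH0_map R N f X = the_elem ((\<lambda>m. HH0_class R N (f m)) ` X)"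

definition cyc :: "('r, 'x) ring_scheme \<Rightarrow> ('s, 'y) ring_scheme \<Rightarrow> ('r, 's, 'm) bimod \<Rightarrow>
    ('s, 'r, 'n) bimod \<Rightarrow> ('m, 'n) tens set \<Rightarrow> ('n, 'm) tens set" where
  "cyc R S M N X = the_elem
     (tensor_lift (HH0 S (tensor R N M)) (\<lambda>m n. HH0_class S (tensor R N M) (pure_tensor R N M n m)) ` X)"

abbreviation twisted_HH0 :: "('g, 'r) gring \<Rightarrow> 'g \<Rightarrow> ('r, 'r, 'm) bimod \<Rightarrow> 'm set monoid" where
  "twisted_HH0 R g M \<equiv> HH0 R (ltwist R g M)"

abbreviation twisted_HH0_class :: "('g, 'r) gring \<Rightarrow> 'g \<Rightarrow> ('r, 'r, 'm) bimod \<Rightarrow> 'm \<Rightarrow> 'm set" where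
  "twisted_HH0_class R g M \<equiv> HH0_class R (ltwist R g M)"

abbreviation twisted_HH0_map :: "('g, 'r) gring \<Rightarrow> 'g \<Rightarrow> ('r, 'r, 'n) bimod \<Rightarrow> ('m \<Rightarrow> 'n) \<Rightarrow>
    'm set \<Rightarrow> 'n set" where
  "twisted_HH0_map R g N \<equiv> HH0_map R (ltwist R g N)"

text \<open>Twisted cyclicity for \<open>M : R \<rightarrow> S\<close> and \<open>(N, \<nu>) : S \<rightarrow> R\<close>: cyclicity, then
  \<open>N \<odot> \<^sup>gM \<cong> N\<^bsup>g\<inverse>\<^esup> \<odot> M\<close>, which is \<open>n \<otimes> m \<mapsto> n \<otimes> m\<close> when \<open>\<^sup>gM\<close> and \<open>N\<^bsup>g\<inverse>\<^esup>\<close> are realised on the groups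
  \<open>M\<close> and \<open>N\<close>, then transport on \<open>N\<close>.\<close>

definition twisted_cyc :: "('g, 'y) monoid_scheme \<Rightarrow> ('g, 'r) gring \<Rightarrow> ('g, 's) gring \<Rightarrow> 'g \<Rightarrow>
    ('r, 's, 'm) bimod \<Rightarrow> ('s, 'r, 'n) bimod \<Rightarrow> ('g, 's, 'r, 'n) twist \<Rightarrow>
    ('m, 'n) tens set \<Rightarrow> ('n, 'm) tens set" where
  "twisted_cyc G R S g M N \<nu> X =
     HH0_map S (tensor R (ltwist S g N) M)
       (tensor_map R (ltwist S g N) M (transport G S R N \<nu> g) (\<lambda>m. m))
       (HH0_map S (tensor R (rtwist R (inv\<^bsub>G\<^esub> g) N) M)
         (tensor_map R (rtwist R (inv\<^bsub>G\<^esub> g) N) M (\<lambda>n. n) (\<lambda>m. m))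
         (cyc R S (ltwist R g M) N X))"


section \<open>Traces\<close>

definition twisted_trace :: "('g, 'y) monoid_scheme \<Rightarrow> ('g, 'r) gring \<Rightarrow> ('g, 's) gring \<Rightarrow>
    ('r, 's, 'p) bimod \<Rightarrow> ('g, 'r, 's, 'p) twist \<Rightarrow> ('s, 'r, 'd) bimod \<Rightarrow>
    ('s \<Rightarrow> ('d, 'p) tens) \<Rightarrow> (('p, 'd) tens \<Rightarrow> 'r) \<Rightarrow> 'g \<Rightarrow> ('p \<Rightarrow> 'p) \<Rightarrow> 's set \<Rightarrow> 'r set" where
  "twisted_trace G R S P \<tau> D \<eta> \<epsilon> g f X =
     twisted_HH0_map R g (unit_bimod R) \<epsilon>
       (twisted_cyc G S R g D P \<tau>
         (twisted_HH0_map S g (tensor R D P) (tensor_map R D P (\<lambda>d. d) f)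
           (twisted_HH0_map S g (tensor R D P) \<eta> X)))"

text \<open>\<open>Hom\<^sub>R(M, N)\<close> as a bimodule. Its elements are extensional, so that equality of elements is
  equality of maps.\<close>

definition lHom :: "('r, 'x) ring_scheme \<Rightarrow> ('r, 's, 'm) bimod \<Rightarrow> ('r, 't, 'n) bimod \<Rightarrow>
    ('s, 't, 'm \<Rightarrow> 'n) bimod" where
  "lHom R M N =
     \<lparr>carrier = {\<xi> \<in> hom M N \<inter> extensional (carrier M).
        \<forall>r \<in> carrier R. \<forall>m \<in> carrier M. \<xi> (lact M r m) = lact N r (\<xi> m)},
      monoid.mult = (\<lambda>\<xi> \<zeta>. \<lambda>m \<in> carrier M. \<xi> m \<otimes>\<^bsub>N\<^esub> \<zeta> m), one = (\<lambda>m \<in> carrier M. \<one>\<^bsub>N\<^esub>),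
      lact = (\<lambda>s \<xi>. \<lambda>m \<in> carrier M. \<xi> (ract M m s)),
      ract = (\<lambda>\<xi> t. \<lambda>m \<in> carrier M. ract N (\<xi> m) t)\<rparr>"

abbreviation ldual :: "('r, 'x) ring_scheme \<Rightarrow> ('r, 's, 'p) bimod \<Rightarrow> ('s, 'r, 'p \<Rightarrow> 'r) bimod" where
  "ldual R P \<equiv> lHom R P (unit_bimod R)"

definition HS_delta :: "('g, 'r) gring \<Rightarrow> ('r, 's, 'p) bimod \<Rightarrow> 'g \<Rightarrow> ('p \<Rightarrow> 'r, 'p) tens \<Rightarrow> 'p \<Rightarrow> 'p" where
  "HS_delta R P g = tensor_lift (lHom R P (ltwist R g P))
     (\<lambda>\<xi> p. \<lambda>x \<in> carrier P. lact (ltwist R g P) (\<xi> x) p)"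

definition HS_pi :: "('g, 'r) gring \<Rightarrow> 'g \<Rightarrow> ('p \<Rightarrow> 'r, 'p) tens \<Rightarrow> 'r set" where
  "HS_pi R g = tensor_lift (twisted_HH0 R g (unit_bimod R))
     (\<lambda>\<xi> p. twisted_HH0_class R g (unit_bimod R) (\<xi> p))"

definition HS_trace :: "('g, 'r) gring \<Rightarrow> ('r, 's, 'p) bimod \<Rightarrow> 'g \<Rightarrow> ('p \<Rightarrow> 'p) \<Rightarrow> 'r set" where
  "HS_trace R P g \<psi> = HS_pi R g
     (inv_into (carrier (tensor R (ldual R P) (ltwist R g P))) (HS_delta R P g)
       (restrict \<psi> (carrier P)))"

definition HS_trace_twist :: "('g, 'y) monoid_scheme \<Rightarrow> ('g, 'r) gring \<Rightarrow> ('g, 's) gring \<Rightarrow>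
    ('r, 's, 'p) bimod \<Rightarrow> ('g, 'r, 's, 'p) twist \<Rightarrow> 'g \<Rightarrow> ('p \<Rightarrow> 'p) \<Rightarrow> 'r set" where
  "HS_trace_twist G R S P \<tau> g h = HS_trace R P g (bitwist G R S P \<tau> g \<circ> h)"

end

theory Submission
  imports Defs
begin

text \<open>
  Let \<open>\<eta>(1) = \<Sum> d\<^sub>i \<otimes> p\<^sub>i\<close> be the coevaluation at the unit of \<open>S\<close>. The first triangle identity says that
  \<open>p = \<Sum> \<epsilon>(p \<otimes> d\<^sub>i) p\<^sub>i\<close> for all \<open>p\<close>, so the \<open>p\<^sub>i\<close> and the functionals \<open>\<epsilon>(- \<otimes> d\<^sub>i)\<close> form a dual basis of \<open>P\<close>
  over \<open>R\<close>. Both sides of the theorem are the class of \<open>\<Sum> \<epsilon>(\<psi>(p\<^sub>i) \<otimes> d\<^sub>i)\<close>, where \<open>\<psi> = \<gamma>\<^sub>g \<circ> f \<circ> \<rho>\<^sub>s\<close>.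

  For the bicategorical trace, this is a computation on elements. The constraint \<open>\<tau>\<close> amounts to
  additive maps \<open>\<phi>\<^sub>g\<close> of the group \<open>P\<close> with \<open>\<tau>\<^sub>g(1 \<otimes> m) = \<phi>\<^sub>g(m) \<otimes> 1\<close>. The axioms of a twist give
  \<open>\<phi>\<^sub>g(r m s) = g(r) \<phi>\<^sub>g(m) g(s)\<close> and make \<open>\<phi>\<close> an action of \<open>G\<close> (\<open>action_equivariant\<close>,
  \<open>action_one\<close>, \<open>action_mult\<close>). The bi-twist isomorphism \<open>\<gamma>\<^sub>g\<close> is \<open>\<phi>\<^sub>g\<close>, and the transport map, which is built from the
  inverse of \<open>\<tau>\<close> at \<open>g\<inverse>\<close>, is \<open>\<phi>\<^sub>g\<close> as well because \<open>\<phi>\<close> is an action (\<open>transport_eq_action\<close>). Hence twisted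
  cyclicity sends the class of \<open>d \<otimes> p\<close> to that of \<open>\<phi>\<^sub>g(p) \<otimes> d\<close> (\<open>twisted_cyc\<close>), and the trace of \<open>f\<close> sends
  \<open>[s]\<close>, with \<open>\<eta>(s) = \<Sum> d\<^sub>i \<otimes> p\<^sub>i s\<close>, to the class of \<open>\<Sum> \<epsilon>(\<phi>\<^sub>g(f(p\<^sub>i s)) \<otimes> d\<^sub>i)\<close>.

  For the Hattori--Stallings trace, the dual basis gives an explicit inverse of \<open>\<delta>\<close>, namely
  \<open>\<psi> \<mapsto> \<Sum> \<epsilon>(- \<otimes> d\<^sub>i) \<otimes> \<psi>(p\<^sub>i)\<close> (\<open>HS_delta_delta_lift\<close>, \<open>delta_lift_HS_delta\<close>), and \<open>\<pi>\<close> maps this element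
  to the same class. Finally \<open>f \<circ> \<rho>\<^sub>s\<close> and \<open>\<rho>\<^sub>s \<circ> f\<close> agree because \<open>f\<close> is right \<open>S\<close>-linear.

  The sums over \<open>i\<close> never appear explicitly: each of them is the value at \<open>\<eta>(1)\<close> of a homomorphism on
  \<open>D \<odot> P\<close> that is known on pure tensors, and two homomorphisms on a tensor product that agree on pure
  tensors are equal (\<open>hom_ext\<close>).
\<close>


section \<open>Quotients of commutative groups\<close>

lemma comm_group_cong:
  assumes "comm_group A" and "carrier B = carrier A" "monoid.mult B = monoid.mult A" "one B = one A"
  shows "comm_group B"
proof -
  interpret A: comm_group A by fact
  show ?thesis
    by (rule comm_groupI) (auto simp: assms A.m_ac intro: A.l_inv_ex)
qed

lemma (in comm_group) hom_Mod_generate: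
  assumes "X \<subseteq> carrier G"
  shows "(\<lambda>a. generate G X #> a) \<in> hom G (G Mod generate G X)"
  using assms by (intro normal.r_coset_hom_Mod subgroup_imp_normal generate_is_subgroup)

lemma (in comm_group) comm_group_Mod_generate:
  assumes "X \<subseteq> carrier G"
  shows "comm_group (G Mod generate G X)"
proof -
  let ?q = "\<lambda>a. generate G X #> a"
  interpret Q: group "G Mod generate G X"
    using assms by (intro normal.factorgroup_is_group subgroup_imp_normal generate_is_subgroup)
  have q: "?q a \<otimes>\<^bsub>G Mod generate G X\<^esub> ?q b = ?q (a \<otimes> b)" if "a \<in> carrier G" "b \<in> carrier G" for a b
    using hom_mult [OF hom_Mod_generate [OF assms]] that by simp
  show ?thesis
  proof (rule Q.group_comm_groupI)
    fix x y
    assume "x \<in> carrier (G Mod generate G X)" "y \<in> carrier (G Mod generate G X)"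
    then obtain a b where "a \<in> carrier G" "x = ?q a" "b \<in> carrier G" "y = ?q b"
      unfolding carrier_FactGroup by blast
    then show "x \<otimes>\<^bsub>G Mod generate G X\<^esub> y = y \<otimes>\<^bsub>G Mod generate G X\<^esub> x"
      by (simp only: q m_comm)
  qed
qed

lemma (in comm_group) Mod_generate_eq:
  assumes "X \<subseteq> carrier G" "a \<otimes> inv b \<in> X" "a \<in> carrier G" "b \<in> carrier G"
  shows "generate G X #> a = generate G X #> b"
proof -
  have sub: "subgroup (generate G X) G"
    using assms(1) by (rule generate_is_subgroup)
  have "a \<in> generate G X #> b"
    using assms generate.incl [OF assms(2)] sub
    by (intro subgroup.rcos_module_rev [OF sub is_group]) auto
  then show ?thesis
    using repr_independence [OF _ _ sub, of a b] assms by auto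
qed

lemma (in comm_group) image_coset_generate:
  assumes "X \<subseteq> carrier G" "group A" "h \<in> hom G A" "\<And>x. x \<in> X \<Longrightarrow> h x = \<one>\<^bsub>A\<^esub>"
    and "a \<in> carrier G"
  shows "h ` (generate G X #> a) = {h a}"
proof -
  interpret h: group_hom G A h
    using assms is_group by (simp add: group_hom_def group_hom_axioms_def)
  have "generate G X \<subseteq> kernel G A h"
    using assms by (intro generate_subgroup_incl h.subgroup_kernel) (auto simp: kernel_def)
  then have "h (k \<otimes> a) = h a" if "k \<in> generate G X" for k
    using that assms(5) by (auto simp: kernel_def subset_iff)
  moreover have "\<one> \<in> generate G X"
    by (rule generate.one)
  ultimately show ?thesis
    unfolding r_coset_def by (intro equalityI subsetI) (auto simp: image_iff)
qed

text \<open>The maps out of tensor products and out of \<open>HH\<^sub>0\<close> are all of the form \<open>C \<mapsto> the_elem (h ` C)\<close>.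
  This is the universal property of the quotient for that form.\<close>

lemma (in comm_group) the_elem_image_coset:
  assumes "X \<subseteq> carrier G" "group A" "h \<in> hom G A" "\<And>x. x \<in> X \<Longrightarrow> h x = \<one>\<^bsub>A\<^esub>"
  shows the_elem_image_coset_eq: "a \<in> carrier G \<Longrightarrow> the_elem (h ` (generate G X #> a)) = h a"
    and the_elem_image_hom: "(\<lambda>C. the_elem (h ` C)) \<in> hom (G Mod generate G X) A"
proof -
  let ?q = "\<lambda>a. generate G X #> a"
  show eq: "the_elem (h ` ?q a) = h a" if "a \<in> carrier G" for a
    using image_coset_generate [OF assms that] by simp
  show "(\<lambda>C. the_elem (h ` C)) \<in> hom (G Mod generate G X) A"
  proof (rule homI)
    fix x
    assume "x \<in> carrier (G Mod generate G X)"
    then show "the_elem (h ` x) \<in> carrier A"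
      using eq assms(3) unfolding carrier_FactGroup by (auto simp: hom_def)
  next
    fix x y
    assume "x \<in> carrier (G Mod generate G X)" "y \<in> carrier (G Mod generate G X)"
    then obtain a b where ab: "a \<in> carrier G" "x = ?q a" "b \<in> carrier G" "y = ?q b"
      unfolding carrier_FactGroup by blast
    then have "x \<otimes>\<^bsub>G Mod generate G X\<^esub> y = ?q (a \<otimes> b)"
      using hom_mult [OF hom_Mod_generate [OF assms(1)]] by simp
    then show "the_elem (h ` (x \<otimes>\<^bsub>G Mod generate G X\<^esub> y)) = the_elem (h ` x) \<otimes>\<^bsub>A\<^esub> the_elem (h ` y)"
      using ab eq hom_mult [OF assms(3)] by simp
  qed
qed

lemma (in comm_group) hom_pointwise_mult:
  assumes "h \<in> hom H G" "k \<in> hom H G"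
  shows "(\<lambda>x. h x \<otimes> k x) \<in> hom H G"
  using assms by (auto simp: hom_def Pi_iff m_ac)

text \<open>The homomorphism from a free Abelian group that extends \<open>f\<close>, in the form in which it occurs in
  \<^const>\<open>tensor_lift\<close>. Its support varies with \<open>c\<close>, so additivity is shown on a common finite
  superset of the supports, where the additional factors are trivial.\<close>

lemma (in comm_group) finprod_int_pow_free:
  assumes f: "f ` S \<subseteq> carrier G"
  shows finprod_int_pow_hom:
      "(\<lambda>c. finprod G (\<lambda>x. f x [^] Poly_Mapping.lookup c x) (Poly_Mapping.keys c))
         \<in> hom (free_Abelian_group S) G" (is "?F \<in> _")
    and finprod_int_pow_frag_of:
      "x \<in> S \<Longrightarrow> finprod G (\<lambda>y. f y [^] Poly_Mapping.lookup (frag_of x) y) (Poly_Mapping.keys (frag_of x)) = f x"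
proof -
  have pow: "(\<lambda>x. f x [^] Poly_Mapping.lookup c x) \<in> T \<rightarrow> carrier G" if "T \<subseteq> S" for c :: "_ \<Rightarrow>\<^sub>0 int" and T
  proof (rule funcsetI)
    fix x
    assume "x \<in> T"
    with f that have "f x \<in> carrier G"
      by blast
    then show "f x [^] Poly_Mapping.lookup c x \<in> carrier G"
      by (rule int_pow_closed)
  qed
  have F: "?F c = finprod G (\<lambda>x. f x [^] Poly_Mapping.lookup c x) T"
    if "finite T" "Poly_Mapping.keys c \<subseteq> T" "T \<subseteq> S" for c :: "_ \<Rightarrow>\<^sub>0 int" and T
    using that pow [OF that(3)]
    by (intro finprod_mono_neutral_cong_left) (auto simp: in_keys_iff)
  show "?F \<in> hom (free_Abelian_group S) G"
  proof (rule homI)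
    fix c
    assume "c \<in> carrier (free_Abelian_group S)"
    then show "?F c \<in> carrier G"
      using pow by simp
  next
    fix c d
    assume "c \<in> carrier (free_Abelian_group S)" "d \<in> carrier (free_Abelian_group S)"
    then have T: "Poly_Mapping.keys c \<union> Poly_Mapping.keys d \<subseteq> S" (is "?T \<subseteq> S")
      by simp
    have "?F (c + d) = finprod G (\<lambda>x. f x [^] (Poly_Mapping.lookup c x + Poly_Mapping.lookup d x)) ?T"
      using F [of ?T "c + d"] T keys_add [of c d] by (simp add: lookup_add)
    also have "\<dots> = finprod G (\<lambda>x. f x [^] Poly_Mapping.lookup c x \<otimes> f x [^] Poly_Mapping.lookup d x) ?T"
      using f T by (intro finprod_cong') (auto intro!: int_pow_closed simp: int_pow_mult image_subset_iff)
    also have "\<dots> = ?F c \<otimes> ?F d"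
      using pow [OF T] F [of ?T c] F [of ?T d] T by (simp add: finprod_multf)
    finally show "?F (c \<otimes>\<^bsub>free_Abelian_group S\<^esub> d) = ?F c \<otimes> ?F d"
      by simp
  qed
  show "?F (frag_of x) = f x" if "x \<in> S"
    using f that by (simp add: image_subset_iff int_pow_1)
qed


section \<open>Bimodule homomorphisms\<close>

lemma bimod_homD:
  assumes "f \<in> bimod_hom R S M N"
  shows "f \<in> hom M N"
    and "m \<in> carrier M \<Longrightarrow> f m \<in> carrier N"
    and "m \<in> carrier M \<Longrightarrow> m' \<in> carrier M \<Longrightarrow> f (m \<otimes>\<^bsub>M\<^esub> m') = f m \<otimes>\<^bsub>N\<^esub> f m'"
    and "r \<in> carrier R \<Longrightarrow> m \<in> carrier M \<Longrightarrow> f (lact M r m) = lact N r (f m)"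
    and "s \<in> carrier S \<Longrightarrow> m \<in> carrier M \<Longrightarrow> f (ract M m s) = ract N (f m) s"
  using assms by (auto simp: bimod_hom_def hom_def)

lemma bimod_homI:
  assumes "\<And>m. m \<in> carrier M \<Longrightarrow> f m \<in> carrier N"
    and "\<And>m m'. m \<in> carrier M \<Longrightarrow> m' \<in> carrier M \<Longrightarrow> f (m \<otimes>\<^bsub>M\<^esub> m') = f m \<otimes>\<^bsub>N\<^esub> f m'"
    and "\<And>r m. r \<in> carrier R \<Longrightarrow> m \<in> carrier M \<Longrightarrow> f (lact M r m) = lact N r (f m)"
    and "\<And>s m. s \<in> carrier S \<Longrightarrow> m \<in> carrier M \<Longrightarrow> f (ract M m s) = ract N (f m) s"
  shows "f \<in> bimod_hom R S M N"
  using assms by (auto simp: bimod_hom_def hom_def)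

lemmas (in bimodule) bimodule_simps =
  lact_closed ract_closed lact_add ract_add add_lact add_ract mult_lact mult_ract
  one_lact one_ract lact_ract

lemma (in bimodule) lact_hom: "r \<in> carrier R \<Longrightarrow> lact M r \<in> hom M M"
  by (auto simp: hom_def bimodule_simps)

lemma (in bimodule) ract_hom: "s \<in> carrier S \<Longrightarrow> (\<lambda>m. ract M m s) \<in> hom M M"
  by (auto simp: hom_def bimodule_simps)

lemma unit_bimod_simps [simp]:
  "carrier (unit_bimod R) = carrier R" "x \<otimes>\<^bsub>unit_bimod R\<^esub> y = x \<oplus>\<^bsub>R\<^esub> y" "\<one>\<^bsub>unit_bimod R\<^esub> = \<zero>\<^bsub>R\<^esub>"
  "lact (unit_bimod R) r x = r \<otimes>\<^bsub>R\<^esub> x" "ract (unit_bimod R) x r = x \<otimes>\<^bsub>R\<^esub> r"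
  by (simp_all add: unit_bimod_def)

lemma (in ring) comm_group_unit_bimod: "comm_group (unit_bimod R)"
  by (rule comm_group_cong [OF a_comm_group]) (simp_all add: unit_bimod_def)

lemma (in ring) bimodule_unit_bimod: "bimodule R R (unit_bimod R)"
  by (intro bimodule.intro bimodule_axioms.intro ring_axioms comm_group_unit_bimod)
    (auto simp: l_distr r_distr m_assoc)


section \<open>Tensor products\<close>

text \<open>The conditions under which \<open>\<beta>\<close> induces a homomorphism from \<open>M \<odot> N\<close> to a commutative group \<open>A\<close>.\<close>

definition balanced :: "('s, 'x) ring_scheme \<Rightarrow> ('r, 's, 'm) bimod \<Rightarrow> ('s, 't, 'n) bimod \<Rightarrow>
    ('a, 'y) monoid_scheme \<Rightarrow> ('m \<Rightarrow> 'n \<Rightarrow> 'a) \<Rightarrow> bool" where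
  "balanced S M N A \<beta> \<longleftrightarrow>
     (\<forall>m \<in> carrier M. \<forall>n \<in> carrier N. \<beta> m n \<in> carrier A) \<and>
     (\<forall>m \<in> carrier M. \<forall>m' \<in> carrier M. \<forall>n \<in> carrier N. \<beta> (m \<otimes>\<^bsub>M\<^esub> m') n = \<beta> m n \<otimes>\<^bsub>A\<^esub> \<beta> m' n) \<and>
     (\<forall>m \<in> carrier M. \<forall>n \<in> carrier N. \<forall>n' \<in> carrier N. \<beta> m (n \<otimes>\<^bsub>N\<^esub> n') = \<beta> m n \<otimes>\<^bsub>A\<^esub> \<beta> m n') \<and>
     (\<forall>m \<in> carrier M. \<forall>s \<in> carrier S. \<forall>n \<in> carrier N. \<beta> (ract M m s) n = \<beta> m (lact N s n))"

lemma balancedI: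
  assumes "\<And>m n. m \<in> carrier M \<Longrightarrow> n \<in> carrier N \<Longrightarrow> \<beta> m n \<in> carrier A"
    and "\<And>m m' n. m \<in> carrier M \<Longrightarrow> m' \<in> carrier M \<Longrightarrow> n \<in> carrier N \<Longrightarrow>
      \<beta> (m \<otimes>\<^bsub>M\<^esub> m') n = \<beta> m n \<otimes>\<^bsub>A\<^esub> \<beta> m' n"
    and "\<And>m n n'. m \<in> carrier M \<Longrightarrow> n \<in> carrier N \<Longrightarrow> n' \<in> carrier N \<Longrightarrow>
      \<beta> m (n \<otimes>\<^bsub>N\<^esub> n') = \<beta> m n \<otimes>\<^bsub>A\<^esub> \<beta> m n'"
    and "\<And>m s n. m \<in> carrier M \<Longrightarrow> s \<in> carrier S \<Longrightarrow> n \<in> carrier N \<Longrightarrow>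
      \<beta> (ract M m s) n = \<beta> m (lact N s n)"
  shows "balanced S M N A \<beta>"
  using assms by (simp add: balanced_def)

lemma balancedD:
  assumes "balanced S M N A \<beta>"
  shows "m \<in> carrier M \<Longrightarrow> n \<in> carrier N \<Longrightarrow> \<beta> m n \<in> carrier A"
    and "m \<in> carrier M \<Longrightarrow> m' \<in> carrier M \<Longrightarrow> n \<in> carrier N \<Longrightarrow>
      \<beta> (m \<otimes>\<^bsub>M\<^esub> m') n = \<beta> m n \<otimes>\<^bsub>A\<^esub> \<beta> m' n"
    and "m \<in> carrier M \<Longrightarrow> n \<in> carrier N \<Longrightarrow> n' \<in> carrier N \<Longrightarrow>
      \<beta> m (n \<otimes>\<^bsub>N\<^esub> n') = \<beta> m n \<otimes>\<^bsub>A\<^esub> \<beta> m n'"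
    and "m \<in> carrier M \<Longrightarrow> s \<in> carrier S \<Longrightarrow> n \<in> carrier N \<Longrightarrow>
      \<beta> (ract M m s) n = \<beta> m (lact N s n)"
  using assms by (simp_all add: balanced_def)

lemma tensor_simps:
  "carrier (tensor S M N) = carrier (tensor_group S M N)"
  "monoid.mult (tensor S M N) = monoid.mult (tensor_group S M N)"
  "one (tensor S M N) = one (tensor_group S M N)"
  by (simp_all add: tensor_def)

locale tensor_pair = M: bimodule R S M + N: bimodule S T N
  for R :: "('r, 'w) ring_scheme" and S :: "('s, 'x) ring_scheme" and T :: "('t, 'y) ring_scheme"
    and M :: "('r, 's, 'm) bimod" and N :: "('s, 't, 'n) bimod"
begin

abbreviation Fr :: "('m \<times> 'n \<Rightarrow>\<^sub>0 int) monoid" where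
  "Fr \<equiv> free_Abelian_group (carrier M \<times> carrier N)"

sublocale Fr: comm_group Fr
  by (rule abelian_free_Abelian_group)

lemma tensor_rel_carrier: "tensor_rel S M N \<subseteq> carrier Fr"
proof -
  have "frag_of (a, b) \<in> carrier Fr" if "a \<in> carrier M" "b \<in> carrier N" for a b
    using that by simp
  moreover have "x - y \<in> carrier Fr" if "x \<in> carrier Fr" "y \<in> carrier Fr" for x y
    using that keys_diff [of x y] by auto
  ultimately show ?thesis
    unfolding tensor_rel_def by (auto simp del: carrier_free_Abelian_group_iff simp: M.ract_closed N.lact_closed)
qed

lemma comm_group_tensor: "comm_group (tensor S M N)"
  by (rule comm_group_cong [OF Fr.comm_group_Mod_generate [OF tensor_rel_carrier]])
    (simp_all only: tensor_simps tensor_group_def tensor_ker_def)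

sublocale MN: comm_group "tensor S M N"
  by (rule comm_group_tensor)

lemma coset_hom: "(\<lambda>c. tensor_ker S M N #>\<^bsub>Fr\<^esub> c) \<in> hom Fr (tensor S M N)"
  using Fr.hom_Mod_generate [OF tensor_rel_carrier]
  by (simp add: hom_def tensor_simps tensor_group_def tensor_ker_def)

lemma coset_mult:
  assumes "a \<in> carrier Fr" "b \<in> carrier Fr"
  shows "tensor_ker S M N #>\<^bsub>Fr\<^esub> (a + b) =
    (tensor_ker S M N #>\<^bsub>Fr\<^esub> a) \<otimes>\<^bsub>tensor S M N\<^esub> (tensor_ker S M N #>\<^bsub>Fr\<^esub> b)"
  using hom_mult [OF coset_hom assms] by simp

lemma coset_eq:
  assumes "a - b \<in> tensor_rel S M N" "a \<in> carrier Fr" "b \<in> carrier Fr"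
  shows "tensor_ker S M N #>\<^bsub>Fr\<^esub> a = tensor_ker S M N #>\<^bsub>Fr\<^esub> b"
  using Fr.Mod_generate_eq [OF tensor_rel_carrier _ assms(2,3)] assms
  by (simp add: tensor_ker_def)

lemma balanced_pure: "balanced S M N (tensor S M N) (pure_tensor S M N)"
proof (rule balancedI)
  fix m n
  assume "m \<in> carrier M" "n \<in> carrier N"
  then show "pure_tensor S M N m n \<in> carrier (tensor S M N)"
    unfolding pure_tensor_def by (intro hom_in_carrier [OF coset_hom]) simp
next
  fix m m' n
  assume *: "m \<in> carrier M" "m' \<in> carrier M" "n \<in> carrier N"
  have "pure_tensor S M N (m \<otimes>\<^bsub>M\<^esub> m') n = tensor_ker S M N #>\<^bsub>Fr\<^esub> (frag_of (m, n) + frag_of (m', n))"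
    unfolding pure_tensor_def using * keys_add [of "frag_of (m, n)" "frag_of (m', n)"]
    by (intro coset_eq) (auto simp: tensor_rel_def algebra_simps)
  with * show "pure_tensor S M N (m \<otimes>\<^bsub>M\<^esub> m') n =
      pure_tensor S M N m n \<otimes>\<^bsub>tensor S M N\<^esub> pure_tensor S M N m' n"
    using coset_mult [of "frag_of (m, n)" "frag_of (m', n)"] unfolding pure_tensor_def by simp
next
  fix m n n'
  assume *: "m \<in> carrier M" "n \<in> carrier N" "n' \<in> carrier N"
  have "pure_tensor S M N m (n \<otimes>\<^bsub>N\<^esub> n') = tensor_ker S M N #>\<^bsub>Fr\<^esub> (frag_of (m, n) + frag_of (m, n'))"
    unfolding pure_tensor_def using * keys_add [of "frag_of (m, n)" "frag_of (m, n')"]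
    by (intro coset_eq) (auto simp: tensor_rel_def algebra_simps)
  with * show "pure_tensor S M N m (n \<otimes>\<^bsub>N\<^esub> n') =
      pure_tensor S M N m n \<otimes>\<^bsub>tensor S M N\<^esub> pure_tensor S M N m n'"
    using coset_mult [of "frag_of (m, n)" "frag_of (m, n')"] unfolding pure_tensor_def by simp
next
  fix m s n
  assume "m \<in> carrier M" "s \<in> carrier S" "n \<in> carrier N"
  then show "pure_tensor S M N (ract M m s) n = pure_tensor S M N m (lact N s n)"
    unfolding pure_tensor_def
    by (intro coset_eq) (auto simp: tensor_rel_def M.ract_closed N.lact_closed)
qed

lemmas pure_closed = balancedD(1) [OF balanced_pure]
lemmas pure_add_left = balancedD(2) [OF balanced_pure]
lemmas pure_add_right = balancedD(3) [OF balanced_pure]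
lemmas pure_balanced = balancedD(4) [OF balanced_pure]

text \<open>The universal property of the tensor product: a balanced map kills each generator of
  \<^const>\<open>tensor_ker\<close>, so its extension to the free Abelian group is constant on cosets.\<close>

lemma tensor_lift:
  assumes A: "comm_group A" and \<beta>: "balanced S M N A \<beta>"
  shows tensor_lift_hom: "tensor_lift A \<beta> \<in> hom (tensor S M N) A"
    and tensor_lift_pure: "m \<in> carrier M \<Longrightarrow> n \<in> carrier N \<Longrightarrow>
      tensor_lift A \<beta> (pure_tensor S M N m n) = \<beta> m n"
proof -
  interpret A: comm_group A by (rule A)
  let ?F = "\<lambda>c. finprod A (\<lambda>(m, n). \<beta> m n [^]\<^bsub>A\<^esub> Poly_Mapping.lookup c (m, n)) (Poly_Mapping.keys c)"
  let ?f = "\<lambda>(m, n). \<beta> m n"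
  have eq: "?F = (\<lambda>c. finprod A (\<lambda>x. ?f x [^]\<^bsub>A\<^esub> Poly_Mapping.lookup c x) (Poly_Mapping.keys c))"
    by (simp add: case_prod_beta')
  have f: "?f ` (carrier M \<times> carrier N) \<subseteq> carrier A"
    using balancedD(1) [OF \<beta>] by auto
  have hom: "?F \<in> hom Fr A"
    unfolding eq by (rule A.finprod_int_pow_hom [OF f])
  have of: "?F (frag_of (m, n)) = \<beta> m n" if "m \<in> carrier M" "n \<in> carrier N" for m n
    unfolding fun_cong [OF eq] using A.finprod_int_pow_frag_of [OF f, of "(m, n)"] that by simp
  interpret F: group_hom Fr A ?F
    using hom by (simp add: group_hom_def group_hom_axioms_def)
  have diff: "?F (x - y) = ?F x \<otimes>\<^bsub>A\<^esub> inv\<^bsub>A\<^esub> ?F y" if "x \<in> carrier Fr" "y \<in> carrier Fr" for x y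
    using F.hom_mult [OF that(1), of "inv\<^bsub>Fr\<^esub> y"] F.hom_inv [OF that(2)] that by simp
  have fr: "frag_of (m, n) \<in> carrier Fr" if "m \<in> carrier M" "n \<in> carrier N" for m n
    using that by simp
  have dc: "x - y \<in> carrier Fr" if "x \<in> carrier Fr" "y \<in> carrier Fr" for x y
    using that keys_diff [of x y] by auto
  have rel: "?F x = \<one>\<^bsub>A\<^esub>" if "x \<in> tensor_rel S M N" for x
  proof -
    have cancel: "(u \<otimes>\<^bsub>A\<^esub> v) \<otimes>\<^bsub>A\<^esub> inv\<^bsub>A\<^esub> u \<otimes>\<^bsub>A\<^esub> inv\<^bsub>A\<^esub> v = \<one>\<^bsub>A\<^esub>"
      if "u \<in> carrier A" "v \<in> carrier A" for u v
      using that by (simp add: A.m_comm [of u v] A.m_assoc)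
    show ?thesis
      using that unfolding tensor_rel_def
    proof (elim UnE CollectE exE conjE)
      fix m m' n
      assume "m \<in> carrier M" "m' \<in> carrier M" "n \<in> carrier N"
        "x = frag_of (m \<otimes>\<^bsub>M\<^esub> m', n) - frag_of (m, n) - frag_of (m', n)"
      then show ?thesis
        by (simp only: diff fr dc of balancedD [OF \<beta>] M.M.m_closed cancel)
    next
      fix m n n'
      assume "m \<in> carrier M" "n \<in> carrier N" "n' \<in> carrier N"
        "x = frag_of (m, n \<otimes>\<^bsub>N\<^esub> n') - frag_of (m, n) - frag_of (m, n')"
      then show ?thesis
        by (simp only: diff fr dc of balancedD [OF \<beta>] N.M.m_closed cancel)
    next
      fix m s n
      assume "m \<in> carrier M" "s \<in> carrier S" "n \<in> carrier N"
        "x = frag_of (ract M m s, n) - frag_of (m, lact N s n)"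
      then show ?thesis
        by (simp only: diff fr dc of balancedD [OF \<beta>] M.ract_closed N.lact_closed A.r_inv)
    qed
  qed
  note lift = Fr.the_elem_image_coset [OF tensor_rel_carrier A.is_group hom rel]
  show "tensor_lift A \<beta> \<in> hom (tensor S M N) A"
    using lift(2) by (simp add: hom_def tensor_simps tensor_group_def tensor_ker_def tensor_lift_def [abs_def])
  show "tensor_lift A \<beta> (pure_tensor S M N m n) = \<beta> m n" if "m \<in> carrier M" "n \<in> carrier N"
    unfolding tensor_lift_def pure_tensor_def tensor_ker_def
    using lift(1) [OF _ fr [OF that]] of [OF that] by simp
qed

text \<open>Pure tensors generate, so homomorphisms that agree on them are equal. This takes the place of
  calculations with sums of pure tensors.\<close>

lemma hom_ext:
  assumes A: "group A" and hk: "h \<in> hom (tensor S M N) A" "k \<in> hom (tensor S M N) A"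
    and eq: "\<And>m n. m \<in> carrier M \<Longrightarrow> n \<in> carrier N \<Longrightarrow>
      h (pure_tensor S M N m n) = k (pure_tensor S M N m n)"
    and x: "x \<in> carrier (tensor S M N)"
  shows "h x = k x"
proof -
  let ?q = "\<lambda>c. tensor_ker S M N #>\<^bsub>Fr\<^esub> c"
  have H: "group_hom Fr A (\<lambda>c. l (?q c))" if "l \<in> hom (tensor S M N) A" for l
    using hom_compose [OF coset_hom that] A by (simp add: group_hom_def group_hom_axioms_def comp_def)
  interpret h: group_hom Fr A "\<lambda>c. h (?q c)" by (rule H [OF hk(1)])
  interpret k: group_hom Fr A "\<lambda>c. k (?q c)" by (rule H [OF hk(2)])
  obtain c where c: "c \<in> carrier Fr" "x = ?q c"
    using x unfolding tensor_simps tensor_group_def carrier_FactGroup by blast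
  from c(1) have "Poly_Mapping.keys c \<subseteq> carrier M \<times> carrier N"
    by simp
  then have "c \<in> carrier Fr \<and> h (?q c) = k (?q c)"
  proof (induction c rule: frag_induction)
    case zero
    then show ?case
      using h.hom_one k.hom_one by simp
  next
    case (one x)
    then show ?case
      using eq by (auto simp: pure_tensor_def)
  next
    case (diff a b)
    then have "h (?q (a \<otimes>\<^bsub>Fr\<^esub> inv\<^bsub>Fr\<^esub> b)) = k (?q (a \<otimes>\<^bsub>Fr\<^esub> inv\<^bsub>Fr\<^esub> b))"
      by (simp only: h.hom_mult k.hom_mult Fr.inv_closed h.hom_inv k.hom_inv)
    then show ?case
      using diff keys_diff [of a b] by auto
  qed
  then show ?thesis
    using c by simp
qed

end

context tensor_pair
begin

text \<open>The two actions on \<open>M \<odot> N\<close> are defined by \<^const>\<open>tensor_lift\<close> into the underlying group, which is a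
  record of another type than the bimodule.\<close>

lemma tensor_lift_tensor_group:
  assumes "balanced S M N (tensor S M N) \<beta>"
  shows "tensor_lift (tensor_group S M N) \<beta> \<in> hom (tensor S M N) (tensor S M N)"
    and "m \<in> carrier M \<Longrightarrow> n \<in> carrier N \<Longrightarrow>
      tensor_lift (tensor_group S M N) \<beta> (pure_tensor S M N m n) = \<beta> m n"
proof -
  have 1: "comm_group (tensor_group S M N)"
    by (rule comm_group_cong [OF comm_group_tensor]) (simp_all only: tensor_simps)
  have 2: "balanced S M N (tensor_group S M N) \<beta>"
    using assms by (simp add: balanced_def tensor_simps)
  show "tensor_lift (tensor_group S M N) \<beta> \<in> hom (tensor S M N) (tensor S M N)"
    using tensor_lift_hom [OF 1 2] by (simp add: hom_def tensor_simps)
  show "m \<in> carrier M \<Longrightarrow> n \<in> carrier N \<Longrightarrow>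
      tensor_lift (tensor_group S M N) \<beta> (pure_tensor S M N m n) = \<beta> m n"
    by (rule tensor_lift_pure [OF 1 2])
qed

lemma
  assumes "r \<in> carrier R"
  shows lact_tensor_hom: "lact (tensor S M N) r \<in> hom (tensor S M N) (tensor S M N)"
    and lact_pure: "m \<in> carrier M \<Longrightarrow> n \<in> carrier N \<Longrightarrow>
      lact (tensor S M N) r (pure_tensor S M N m n) = pure_tensor S M N (lact M r m) n"
proof -
  have "balanced S M N (tensor S M N) (\<lambda>m n. pure_tensor S M N (lact M r m) n)"
    using assms by (intro balancedI)
      (simp_all add: M.bimodule_simps pure_closed pure_add_left pure_add_right pure_balanced
        flip: M.lact_ract)
  from tensor_lift_tensor_group [OF this]
  show "lact (tensor S M N) r \<in> hom (tensor S M N) (tensor S M N)"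
    and "m \<in> carrier M \<Longrightarrow> n \<in> carrier N \<Longrightarrow>
      lact (tensor S M N) r (pure_tensor S M N m n) = pure_tensor S M N (lact M r m) n"
    by (simp_all add: tensor_def)
qed

lemma
  assumes "t \<in> carrier T"
  shows ract_tensor_hom: "(\<lambda>x. ract (tensor S M N) x t) \<in> hom (tensor S M N) (tensor S M N)"
    and ract_pure: "m \<in> carrier M \<Longrightarrow> n \<in> carrier N \<Longrightarrow>
      ract (tensor S M N) (pure_tensor S M N m n) t = pure_tensor S M N m (ract N n t)"
proof -
  have "balanced S M N (tensor S M N) (\<lambda>m n. pure_tensor S M N m (ract N n t))"
    using assms by (intro balancedI)
      (simp_all add: N.bimodule_simps pure_closed pure_add_left pure_add_right pure_balanced)
  from tensor_lift_tensor_group [OF this]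
  show "(\<lambda>x. ract (tensor S M N) x t) \<in> hom (tensor S M N) (tensor S M N)"
    and "m \<in> carrier M \<Longrightarrow> n \<in> carrier N \<Longrightarrow>
      ract (tensor S M N) (pure_tensor S M N m n) t = pure_tensor S M N m (ract N n t)"
    by (simp_all add: tensor_def)
qed

lemma id_hom_tensor: "(\<lambda>x. x) \<in> hom (tensor S M N) (tensor S M N)"
  by (simp add: hom_def)

text \<open>For a fixed scalar (or pair of scalars) both sides of each bimodule axiom are homomorphisms in
  the remaining tensor \<open>x\<close>, so it suffices to compare them on pure tensors, where the axioms are
  those of \<open>M\<close> or of \<open>N\<close>.\<close>

lemma bimodule_tensor: "bimodule R T (tensor S M N)"
proof (intro bimodule.intro bimodule_axioms.intro M.R.ring_axioms N.S.ring_axioms comm_group_tensor)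
  let ?X = "tensor S M N"
  note ext = hom_ext [OF MN.is_group]
  note L = lact_tensor_hom and Ra = ract_tensor_hom
  note homs = L Ra MN.hom_pointwise_mult [OF L L] MN.hom_pointwise_mult [OF Ra Ra]
    hom_compose [OF L L, unfolded comp_def] hom_compose [OF Ra Ra, unfolded comp_def]
    hom_compose [OF L Ra, unfolded comp_def] hom_compose [OF Ra L, unfolded comp_def] id_hom_tensor
  note pures = lact_pure ract_pure M.bimodule_simps N.bimodule_simps pure_add_left pure_add_right
  fix x
  assume x: "x \<in> carrier ?X"
  {
    fix r assume "r \<in> carrier R"
    then show "lact ?X r x \<in> carrier ?X"
      using x hom_in_carrier [OF L] by blast
  next
    fix t assume "t \<in> carrier T"
    then show "ract ?X x t \<in> carrier ?X"
      using x hom_in_carrier [OF Ra] by blast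
  next
    fix r y assume "r \<in> carrier R" "y \<in> carrier ?X"
    then show "lact ?X r (x \<otimes>\<^bsub>?X\<^esub> y) = lact ?X r x \<otimes>\<^bsub>?X\<^esub> lact ?X r y"
      using x hom_mult [OF L] by blast
  next
    fix t y assume "t \<in> carrier T" "y \<in> carrier ?X"
    then show "ract ?X (x \<otimes>\<^bsub>?X\<^esub> y) t = ract ?X x t \<otimes>\<^bsub>?X\<^esub> ract ?X y t"
      using x hom_mult [OF Ra] by blast
  next
    fix r r' assume "r \<in> carrier R" "r' \<in> carrier R"
    then show "lact ?X (r \<oplus>\<^bsub>R\<^esub> r') x = lact ?X r x \<otimes>\<^bsub>?X\<^esub> lact ?X r' x"
      by - (rule ext [OF _ _ _ x], simp_all add: homs pures)
  next
    fix s s' assume "s \<in> carrier T" "s' \<in> carrier T"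
    then show "ract ?X x (s \<oplus>\<^bsub>T\<^esub> s') = ract ?X x s \<otimes>\<^bsub>?X\<^esub> ract ?X x s'"
      by - (rule ext [OF _ _ _ x], simp_all add: homs pures)
  next
    fix r r' assume "r \<in> carrier R" "r' \<in> carrier R"
    then show "lact ?X (r \<otimes>\<^bsub>R\<^esub> r') x = lact ?X r (lact ?X r' x)"
      by - (rule ext [OF _ _ _ x], simp_all add: homs pures)
  next
    fix s s' assume "s \<in> carrier T" "s' \<in> carrier T"
    then show "ract ?X x (s \<otimes>\<^bsub>T\<^esub> s') = ract ?X (ract ?X x s) s'"
      by - (rule ext [OF _ _ _ x], simp_all add: homs pures)
  next
    show "lact ?X \<one>\<^bsub>R\<^esub> x = x"
      by - (rule ext [OF _ _ _ x], simp_all add: homs pures)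
  next
    show "ract ?X x \<one>\<^bsub>T\<^esub> = x"
      by - (rule ext [OF _ _ _ x], simp_all add: homs pures)
  next
    fix r s assume "r \<in> carrier R" "s \<in> carrier T"
    then show "ract ?X (lact ?X r x) s = lact ?X r (ract ?X x s)"
      by - (rule ext [OF _ _ _ x], simp_all add: homs pures)
  }
qed

lemma bimod_hom_tensorI:
  assumes "bimodule R T A" and h: "h \<in> hom (tensor S M N) A"
    and "\<And>r m n. r \<in> carrier R \<Longrightarrow> m \<in> carrier M \<Longrightarrow> n \<in> carrier N \<Longrightarrow>
      h (pure_tensor S M N (lact M r m) n) = lact A r (h (pure_tensor S M N m n))"
    and "\<And>t m n. t \<in> carrier T \<Longrightarrow> m \<in> carrier M \<Longrightarrow> n \<in> carrier N \<Longrightarrow>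
      h (pure_tensor S M N m (ract N n t)) = ract A (h (pure_tensor S M N m n)) t"
  shows "h \<in> bimod_hom R T (tensor S M N) A"
proof -
  interpret A: bimodule R T A by fact
  show ?thesis
  proof (rule bimod_homI)
    fix x assume "x \<in> carrier (tensor S M N)"
    then show "h x \<in> carrier A"
      by (rule hom_in_carrier [OF h])
  next
    fix x y assume "x \<in> carrier (tensor S M N)" "y \<in> carrier (tensor S M N)"
    then show "h (x \<otimes>\<^bsub>tensor S M N\<^esub> y) = h x \<otimes>\<^bsub>A\<^esub> h y"
      by (rule hom_mult [OF h])
  next
    fix r x assume r: "r \<in> carrier R" and x: "x \<in> carrier (tensor S M N)"
    show "h (lact (tensor S M N) r x) = lact A r (h x)"
      using r hom_compose [OF lact_tensor_hom h, of r] hom_compose [OF h A.lact_hom, of r]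
      by - (rule hom_ext [OF A.M.is_group _ _ _ x], simp_all add: comp_def lact_pure assms(3))
  next
    fix t x assume t: "t \<in> carrier T" and x: "x \<in> carrier (tensor S M N)"
    show "h (ract (tensor S M N) x t) = ract A (h x) t"
      using t hom_compose [OF ract_tensor_hom h, of t] hom_compose [OF h A.ract_hom, of t]
      by - (rule hom_ext [OF A.M.is_group _ _ _ x], simp_all add: comp_def ract_pure assms(4))
  qed
qed

lemma lift_bimod_hom:
  assumes "bimodule R T A" "balanced S M N A \<beta>"
    and "\<And>r m n. r \<in> carrier R \<Longrightarrow> m \<in> carrier M \<Longrightarrow> n \<in> carrier N \<Longrightarrow>
      \<beta> (lact M r m) n = lact A r (\<beta> m n)"
    and "\<And>t m n. t \<in> carrier T \<Longrightarrow> m \<in> carrier M \<Longrightarrow> n \<in> carrier N \<Longrightarrow>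
      \<beta> m (ract N n t) = ract A (\<beta> m n) t"
  shows "tensor_lift A \<beta> \<in> bimod_hom R T (tensor S M N) A"
proof -
  interpret A: bimodule R T A by fact
  note lift = tensor_lift [OF A.M.comm_group_axioms assms(2)]
  show ?thesis
    by (rule bimod_hom_tensorI [OF assms(1) lift(1)])
      (simp_all add: lift(2) assms(3,4) M.lact_closed N.ract_closed)
qed

text \<open>A map on \<open>(M \<odot> N) \<times> L\<close> that is additive in the first argument is balanced as soon as the other
  conditions hold on pure tensors. Together with the mirror image this makes the associators well
  defined.\<close>

lemma balanced_tensor_left:
  assumes "comm_group A" "bimodule T U L"
    and h: "\<And>l. l \<in> carrier L \<Longrightarrow> h l \<in> hom (tensor S M N) A"
    and add: "\<And>l l' m n. l \<in> carrier L \<Longrightarrow> l' \<in> carrier L \<Longrightarrow> m \<in> carrier M \<Longrightarrow> n \<in> carrier N \<Longrightarrow>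
      h (l \<otimes>\<^bsub>L\<^esub> l') (pure_tensor S M N m n) =
        h l (pure_tensor S M N m n) \<otimes>\<^bsub>A\<^esub> h l' (pure_tensor S M N m n)"
    and bal: "\<And>l t m n. l \<in> carrier L \<Longrightarrow> t \<in> carrier T \<Longrightarrow> m \<in> carrier M \<Longrightarrow> n \<in> carrier N \<Longrightarrow>
      h l (pure_tensor S M N m (ract N n t)) = h (lact L t l) (pure_tensor S M N m n)"
  shows "balanced T (tensor S M N) L A (\<lambda>x l. h l x)"
proof (rule balancedI)
  interpret A: comm_group A by fact
  interpret L: bimodule T U L by fact
  fix x l assume xl: "x \<in> carrier (tensor S M N)" "l \<in> carrier L"
  show "h l x \<in> carrier A"
    using xl hom_in_carrier [OF h] by blast
  {
    fix y assume "y \<in> carrier (tensor S M N)"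
    then show "h l (x \<otimes>\<^bsub>tensor S M N\<^esub> y) = h l x \<otimes>\<^bsub>A\<^esub> h l y"
      using xl hom_mult [OF h] by blast
  next
    fix l' assume "l' \<in> carrier L"
    then show "h (l \<otimes>\<^bsub>L\<^esub> l') x = h l x \<otimes>\<^bsub>A\<^esub> h l' x"
      using xl by - (rule hom_ext [OF A.is_group _ _ _ xl(1)], simp_all add: h A.hom_pointwise_mult add)
  next
    fix t assume "t \<in> carrier T"
    then show "h l (ract (tensor S M N) x t) = h (lact L t l) x"
      using xl hom_compose [OF ract_tensor_hom h, of t l]
      by - (rule hom_ext [OF A.is_group _ _ _ xl(1)], simp_all add: h comp_def ract_pure bal L.lact_closed)
  }
qed

lemma balanced_tensor_right:
  assumes "comm_group A" "bimodule Q R L"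
    and h: "\<And>l. l \<in> carrier L \<Longrightarrow> h l \<in> hom (tensor S M N) A"
    and add: "\<And>l l' m n. l \<in> carrier L \<Longrightarrow> l' \<in> carrier L \<Longrightarrow> m \<in> carrier M \<Longrightarrow> n \<in> carrier N \<Longrightarrow>
      h (l \<otimes>\<^bsub>L\<^esub> l') (pure_tensor S M N m n) =
        h l (pure_tensor S M N m n) \<otimes>\<^bsub>A\<^esub> h l' (pure_tensor S M N m n)"
    and bal: "\<And>l r m n. l \<in> carrier L \<Longrightarrow> r \<in> carrier R \<Longrightarrow> m \<in> carrier M \<Longrightarrow> n \<in> carrier N \<Longrightarrow>
      h (ract L l r) (pure_tensor S M N m n) = h l (pure_tensor S M N (lact M r m) n)"
  shows "balanced R L (tensor S M N) A h"
proof (rule balancedI)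
  interpret A: comm_group A by fact
  interpret L: bimodule Q R L by fact
  fix x l assume xl: "l \<in> carrier L" "x \<in> carrier (tensor S M N)"
  show "h l x \<in> carrier A"
    using xl hom_in_carrier [OF h] by blast
  {
    fix y assume "y \<in> carrier (tensor S M N)"
    then show "h l (x \<otimes>\<^bsub>tensor S M N\<^esub> y) = h l x \<otimes>\<^bsub>A\<^esub> h l y"
      using xl hom_mult [OF h] by blast
  next
    fix l' assume "l' \<in> carrier L"
    then show "h (l \<otimes>\<^bsub>L\<^esub> l') x = h l x \<otimes>\<^bsub>A\<^esub> h l' x"
      using xl by - (rule hom_ext [OF A.is_group _ _ _ xl(2)], simp_all add: h A.hom_pointwise_mult add)
  next
    fix r assume "r \<in> carrier R"
    then show "h (ract L l r) x = h l (lact (tensor S M N) r x)"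
      using xl hom_compose [OF lact_tensor_hom h, of r l]
      by - (rule hom_ext [OF A.is_group _ _ _ xl(2)], simp_all add: h comp_def lact_pure bal L.ract_closed)
  }
qed

end

text \<open>The maps \<open>f\<close> and \<open>h\<close> only have to be balanced jointly: this covers maps between tensor products
  in which the action of the middle ring is moved from one factor to the other.\<close>

lemma tensor_map:
  assumes "tensor_pair R S T M N" "tensor_pair R' S' T' M' N'"
    and f: "f \<in> hom M M'" and h: "h \<in> hom N N'"
    and bal: "\<And>m s n. m \<in> carrier M \<Longrightarrow> s \<in> carrier S \<Longrightarrow> n \<in> carrier N \<Longrightarrow>
      pure_tensor S' M' N' (f (ract M m s)) (h n) = pure_tensor S' M' N' (f m) (h (lact N s n))"
  shows tensor_map_hom: "tensor_map S' M' N' f h \<in> hom (tensor S M N) (tensor S' M' N')"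
    and tensor_map_pure: "m \<in> carrier M \<Longrightarrow> n \<in> carrier N \<Longrightarrow>
      tensor_map S' M' N' f h (pure_tensor S M N m n) = pure_tensor S' M' N' (f m) (h n)"
proof -
  interpret MN: tensor_pair R S T M N by fact
  interpret MN': tensor_pair R' S' T' M' N' by fact
  have b: "balanced S M N (tensor S' M' N') (\<lambda>m n. pure_tensor S' M' N' (f m) (h n))"
    using bal by (intro balancedI)
      (simp_all add: hom_mult [OF f] hom_mult [OF h] hom_in_carrier [OF f] hom_in_carrier [OF h]
        MN'.pure_closed MN'.pure_add_left MN'.pure_add_right)
  show "tensor_map S' M' N' f h \<in> hom (tensor S M N) (tensor S' M' N')"
    unfolding tensor_map_def by (rule MN.tensor_lift_hom [OF MN'.comm_group_tensor b])
  show "m \<in> carrier M \<Longrightarrow> n \<in> carrier N \<Longrightarrow>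
      tensor_map S' M' N' f h (pure_tensor S M N m n) = pure_tensor S' M' N' (f m) (h n)"
    unfolding tensor_map_def by (rule MN.tensor_lift_pure [OF MN'.comm_group_tensor b])
qed

lemma tensor_map_bimod_hom:
  assumes "tensor_pair R S T M N" "tensor_pair R S T M' N'"
    and f: "f \<in> bimod_hom R S M M'" and h: "h \<in> bimod_hom S T N N'"
  shows "tensor_map S M' N' f h \<in> bimod_hom R T (tensor S M N) (tensor S M' N')"
    and "m \<in> carrier M \<Longrightarrow> n \<in> carrier N \<Longrightarrow>
      tensor_map S M' N' f h (pure_tensor S M N m n) = pure_tensor S M' N' (f m) (h n)"
proof -
  interpret MN: tensor_pair R S T M N by fact
  interpret MN': tensor_pair R S T M' N' by fact
  note [simp] = bimod_homD(2-) [OF f] bimod_homD(2-) [OF h]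
  show "tensor_map S M' N' f h \<in> bimod_hom R T (tensor S M N) (tensor S M' N')"
    unfolding tensor_map_def
    by (intro MN.lift_bimod_hom MN'.bimodule_tensor balancedI)
      (simp_all add: MN'.pure_closed MN'.pure_add_left MN'.pure_add_right MN'.pure_balanced
        MN'.lact_pure MN'.ract_pure)
  show "m \<in> carrier M \<Longrightarrow> n \<in> carrier N \<Longrightarrow>
      tensor_map S M' N' f h (pure_tensor S M N m n) = pure_tensor S M' N' (f m) (h n)"
    by (intro tensor_map_pure [OF assms(1,2)] bimod_homD(1) [OF f] bimod_homD(1) [OF h])
      (simp_all add: MN'.pure_balanced)
qed

context
  fixes R :: "('r, 'w) ring_scheme" and S :: "('s, 'x) ring_scheme"
    and T :: "('t, 'y) ring_scheme" and U :: "('u, 'z) ring_scheme"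
    and L :: "('r, 's, 'l) bimod" and M :: "('s, 't, 'm) bimod" and N :: "('t, 'u, 'n) bimod"
  assumes L: "bimodule R S L" and M: "bimodule S T M" and N: "bimodule T U N"
begin

interpretation L: bimodule R S L by (rule L)
interpretation M: bimodule S T M by (rule M)
interpretation N: bimodule T U N by (rule N)
interpretation LM: tensor_pair R S T L M using L M by (rule tensor_pair.intro)
interpretation MN: tensor_pair S T U M N using M N by (rule tensor_pair.intro)
interpretation LM_N: tensor_pair R T U "tensor S L M" N
  using LM.bimodule_tensor N by (rule tensor_pair.intro)
interpretation L_MN: tensor_pair R S U L "tensor T M N"
  using L MN.bimodule_tensor by (rule tensor_pair.intro)

lemma assoc_r_pure:
  "l \<in> carrier L \<Longrightarrow> m \<in> carrier M \<Longrightarrow> n \<in> carrier N \<Longrightarrow>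
      assoc_r S T L M N (pure_tensor T (tensor S L M) N (pure_tensor S L M l m) n) =
        pure_tensor S L (tensor T M N) l (pure_tensor T M N m n)"
proof -
  let ?Y = "tensor S L (tensor T M N)"
  let ?b = "\<lambda>n l m. pure_tensor S L (tensor T M N) l (pure_tensor T M N m n)"
  have b: "balanced S L M ?Y (?b n)" if "n \<in> carrier N" for n
    using that by (intro balancedI)
      (simp_all add: L_MN.pure_closed L_MN.pure_add_left L_MN.pure_add_right L_MN.pure_balanced
        MN.pure_closed MN.pure_add_left MN.lact_pure)
  note p = LM.tensor_lift_pure [OF L_MN.comm_group_tensor b]
  have "balanced T (tensor S L M) N ?Y (\<lambda>x n. tensor_lift ?Y (?b n) x)"
    by (intro LM.balanced_tensor_left [OF L_MN.comm_group_tensor N]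
        LM.tensor_lift_hom [OF L_MN.comm_group_tensor b])
      (simp_all add: p M.ract_closed N.lact_closed N.M.m_closed
        L_MN.pure_add_right MN.pure_closed MN.pure_add_right MN.pure_balanced)
  from LM_N.tensor_lift_pure [OF L_MN.comm_group_tensor this]
  show "l \<in> carrier L \<Longrightarrow> m \<in> carrier M \<Longrightarrow> n \<in> carrier N \<Longrightarrow>
      assoc_r S T L M N (pure_tensor T (tensor S L M) N (pure_tensor S L M l m) n) =
        pure_tensor S L (tensor T M N) l (pure_tensor T M N m n)"
    unfolding assoc_r_def by (simp add: p LM.pure_closed)
qed

lemma
  shows assoc_l_hom: "assoc_l S T L M N \<in> hom (tensor S L (tensor T M N)) (tensor T (tensor S L M) N)"
    and assoc_l_pure: "l \<in> carrier L \<Longrightarrow> m \<in> carrier M \<Longrightarrow> n \<in> carrier N \<Longrightarrow>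
      assoc_l S T L M N (pure_tensor S L (tensor T M N) l (pure_tensor T M N m n)) =
        pure_tensor T (tensor S L M) N (pure_tensor S L M l m) n"
proof -
  let ?Y = "tensor T (tensor S L M) N"
  let ?b = "\<lambda>l m n. pure_tensor T (tensor S L M) N (pure_tensor S L M l m) n"
  have b: "balanced T M N ?Y (?b l)" if "l \<in> carrier L" for l
    using that by (intro balancedI)
      (simp_all add: LM_N.pure_closed LM_N.pure_add_left LM_N.pure_add_right
        LM.pure_closed LM.pure_add_right LM_N.pure_balanced flip: LM.ract_pure)
  note p = MN.tensor_lift_pure [OF LM_N.comm_group_tensor b]
  have "balanced S L (tensor T M N) ?Y (\<lambda>l. tensor_lift ?Y (?b l))"
    by (intro MN.balanced_tensor_right [OF LM_N.comm_group_tensor L]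
        MN.tensor_lift_hom [OF LM_N.comm_group_tensor b])
      (simp_all add: p L.ract_closed L.M.m_closed M.lact_closed
        LM_N.pure_add_left LM.pure_closed LM.pure_add_left LM.pure_balanced)
  from L_MN.tensor_lift [OF LM_N.comm_group_tensor this]
  show "assoc_l S T L M N \<in> hom (tensor S L (tensor T M N)) (tensor T (tensor S L M) N)"
    and "l \<in> carrier L \<Longrightarrow> m \<in> carrier M \<Longrightarrow> n \<in> carrier N \<Longrightarrow>
      assoc_l S T L M N (pure_tensor S L (tensor T M N) l (pure_tensor T M N m n)) =
        pure_tensor T (tensor S L M) N (pure_tensor S L M l m) n"
    unfolding assoc_l_def by (simp_all add: p MN.pure_closed)
qed

end

context bimodule
begin

lemma tensor_pair_unit_left: "tensor_pair R R S (unit_bimod R) M"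
  by (intro tensor_pair.intro R.bimodule_unit_bimod bimodule_axioms)

lemma balanced_lact: "balanced R (unit_bimod R) M M (lact M)"
  by (intro balancedI) (simp_all add: bimodule_simps)

lemma lunit_hom: "lunit M \<in> hom (tensor R (unit_bimod R) M) M"
  unfolding lunit_def
  by (rule tensor_pair.tensor_lift_hom [OF tensor_pair_unit_left M.comm_group_axioms balanced_lact])

lemma lunit_pure:
  "r \<in> carrier R \<Longrightarrow> m \<in> carrier M \<Longrightarrow> lunit M (pure_tensor R (unit_bimod R) M r m) = lact M r m"
  unfolding lunit_def
  by (rule tensor_pair.tensor_lift_pure [OF tensor_pair_unit_left M.comm_group_axioms balanced_lact])
    simp_all

end

section \<open>Twisting by the group action\<close>

context G_ring
begin

lemma act_ring_hom: "g \<in> carrier G \<Longrightarrow> act R g \<in> ring_hom R R"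
  and act_bij: "g \<in> carrier G \<Longrightarrow> act R g \<in> Bij (carrier R)"
  using hom_in_carrier [OF act_hom, of g] by (simp_all add: AutoRing_def)

lemma act_closed [simp]: "g \<in> carrier G \<Longrightarrow> r \<in> carrier R \<Longrightarrow> act R g r \<in> carrier R"
  and act_add: "g \<in> carrier G \<Longrightarrow> r \<in> carrier R \<Longrightarrow> r' \<in> carrier R \<Longrightarrow>
    act R g (r \<oplus>\<^bsub>R\<^esub> r') = act R g r \<oplus>\<^bsub>R\<^esub> act R g r'"
  and act_mult: "g \<in> carrier G \<Longrightarrow> r \<in> carrier R \<Longrightarrow> r' \<in> carrier R \<Longrightarrow>
    act R g (r \<otimes>\<^bsub>R\<^esub> r') = act R g r \<otimes>\<^bsub>R\<^esub> act R g r'"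
  and act_ring_one [simp]: "g \<in> carrier G \<Longrightarrow> act R g \<one>\<^bsub>R\<^esub> = \<one>\<^bsub>R\<^esub>"
  using act_ring_hom [of g] by (auto simp: ring_hom_def)

lemma act_comp:
  assumes "g \<in> carrier G" "h \<in> carrier G" "r \<in> carrier R"
  shows "act R (g \<otimes>\<^bsub>G\<^esub> h) r = act R g (act R h r)"
  using hom_mult [OF act_hom, of g h] assms act_bij
  by (simp add: AutoRing_def BijGroup_def compose_def)

lemma act_one:
  assumes "r \<in> carrier R"
  shows "act R \<one>\<^bsub>G\<^esub> r = r"
proof -
  \<comment> \<open>The action of \<open>\<one>\<close> is idempotent and injective.\<close>
  have "inj_on (act R \<one>\<^bsub>G\<^esub>) (carrier R)"
    using act_bij [OF one_closed] by (simp add: Bij_def bij_betw_def)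
  moreover have "act R \<one>\<^bsub>G\<^esub> (act R \<one>\<^bsub>G\<^esub> r) = act R \<one>\<^bsub>G\<^esub> r"
    using assms act_comp [of "\<one>\<^bsub>G\<^esub>" "\<one>\<^bsub>G\<^esub>" r] by simp
  ultimately show ?thesis
    using assms by (auto dest: inj_onD)
qed

lemma act_inv:
  assumes "g \<in> carrier G" "r \<in> carrier R"
  shows "act R (inv\<^bsub>G\<^esub> g) (act R g r) = r" "act R g (act R (inv\<^bsub>G\<^esub> g) r) = r"
  using assms act_comp [of "inv\<^bsub>G\<^esub> g" g r] act_comp [of g "inv\<^bsub>G\<^esub> g" r] act_one by simp_all

end

lemma ltwist_simps [simp]:
  "carrier (ltwist R g M) = carrier M" "x \<otimes>\<^bsub>ltwist R g M\<^esub> y = x \<otimes>\<^bsub>M\<^esub> y" "\<one>\<^bsub>ltwist R g M\<^esub> = \<one>\<^bsub>M\<^esub>"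
  "lact (ltwist R g M) r m = lact M (act R g r) m" "ract (ltwist R g M) = ract M"
  by (simp_all add: ltwist_def)

lemma rtwist_simps [simp]:
  "carrier (rtwist S g M) = carrier M" "x \<otimes>\<^bsub>rtwist S g M\<^esub> y = x \<otimes>\<^bsub>M\<^esub> y" "\<one>\<^bsub>rtwist S g M\<^esub> = \<one>\<^bsub>M\<^esub>"
  "ract (rtwist S g M) m s = ract M m (act S g s)" "lact (rtwist S g M) = lact M"
  by (simp_all add: rtwist_def)

lemma (in G_ring) bimodule_ltwist:
  assumes "bimodule R S M" "g \<in> carrier G"
  shows "bimodule R S (ltwist R g M)"
proof -
  interpret M: bimodule R S M by fact
  have "comm_group (ltwist R g M)"
    by (rule comm_group_cong [OF M.M.comm_group_axioms]) (simp_all add: ltwist_def)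
  then show ?thesis
    using assms(2)
    by (intro bimodule.intro bimodule_axioms.intro bimodule.axioms(1,2) [OF assms(1)])
      (simp_all add: M.bimodule_simps act_add act_mult)
qed

lemma (in G_ring) bimodule_rtwist:
  assumes "bimodule S R M" "g \<in> carrier G"
  shows "bimodule S R (rtwist R g M)"
proof -
  interpret M: bimodule S R M by fact
  have "comm_group (rtwist R g M)"
    by (rule comm_group_cong [OF M.M.comm_group_axioms]) (simp_all add: rtwist_def)
  then show ?thesis
    using assms(2)
    by (intro bimodule.intro bimodule_axioms.intro bimodule.axioms(1,2) [OF assms(1)])
      (simp_all add: M.bimodule_simps act_add act_mult)
qed

lemma Theta_simps [simp]:
  "carrier (Theta R g) = carrier R" "x \<otimes>\<^bsub>Theta R g\<^esub> y = x \<oplus>\<^bsub>R\<^esub> y" "\<one>\<^bsub>Theta R g\<^esub> = \<zero>\<^bsub>R\<^esub>"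
  "lact (Theta R g) r x = r \<otimes>\<^bsub>R\<^esub> x" "ract (Theta R g) x r = x \<otimes>\<^bsub>R\<^esub> act R g r"
  by (simp_all add: Theta_def)

lemma (in G_ring) bimodule_Theta: "g \<in> carrier G \<Longrightarrow> bimodule R R (Theta R g)"
  unfolding Theta_def by (intro bimodule_rtwist R.bimodule_unit_bimod)

lemma id_bimod_hom: "(\<lambda>m. m) \<in> bimod_hom R S M M"
  by (simp add: bimod_hom_def hom_def)

context G_ring
begin

lemma ltwist_can:
  assumes M: "bimodule R S M" and g: "g \<in> carrier G"
  shows ltwist_can_hom: "ltwist_can R g M \<in> hom (tensor R (Theta R (inv\<^bsub>G\<^esub> g)) M) M"
    and ltwist_can_pure: "x \<in> carrier R \<Longrightarrow> m \<in> carrier M \<Longrightarrow>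
      ltwist_can R g M (pure_tensor R (Theta R (inv\<^bsub>G\<^esub> g)) M x m) = lact M (act R g x) m"
proof -
  interpret M: bimodule R S M by fact
  interpret TM: tensor_pair R R S "Theta R (inv\<^bsub>G\<^esub> g)" M
    using g by (intro tensor_pair.intro bimodule_Theta M) simp
  have b: "balanced R (Theta R (inv\<^bsub>G\<^esub> g)) M M (\<lambda>x m. lact M (act R g x) m)"
    using g by (intro balancedI) (simp_all add: M.bimodule_simps act_add act_mult act_inv)
  show "ltwist_can R g M \<in> hom (tensor R (Theta R (inv\<^bsub>G\<^esub> g)) M) M"
    and "x \<in> carrier R \<Longrightarrow> m \<in> carrier M \<Longrightarrow>
      ltwist_can R g M (pure_tensor R (Theta R (inv\<^bsub>G\<^esub> g)) M x m) = lact M (act R g x) m"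
    using TM.tensor_lift [OF M.M.comm_group_axioms b] unfolding ltwist_can_def by simp_all
qed

lemma rtwist_can:
  assumes M: "bimodule S R M" and g: "g \<in> carrier G"
  shows rtwist_can_bimod_hom: "rtwist_can M \<in> bimod_hom S R (tensor R M (Theta R g)) (rtwist R g M)"
    and rtwist_can_pure: "x \<in> carrier R \<Longrightarrow> m \<in> carrier M \<Longrightarrow>
      rtwist_can M (pure_tensor R M (Theta R g) m x) = ract M m x"
proof -
  interpret M: bimodule S R M by fact
  interpret MT: tensor_pair S R R M "Theta R g"
    using g by (intro tensor_pair.intro bimodule_Theta M)
  have b: "balanced R M (Theta R g) M (ract M)"
    using g by (intro balancedI) (simp_all add: M.bimodule_simps)
  note lift = MT.tensor_lift [OF M.M.comm_group_axioms b]
  show pure: "rtwist_can M (pure_tensor R M (Theta R g) m x) = ract M m x"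
    if "x \<in> carrier R" "m \<in> carrier M" for x m
    using lift(2) that unfolding rtwist_can_def by simp
  have "rtwist_can M \<in> hom (tensor R M (Theta R g)) (rtwist R g M)"
    using lift(1) by (simp add: rtwist_can_def hom_def)
  then show "rtwist_can M \<in> bimod_hom S R (tensor R M (Theta R g)) (rtwist R g M)"
    by (rule MT.bimod_hom_tensorI [OF bimodule_rtwist [OF M g]])
      (simp_all add: pure M.bimodule_simps g)
qed

text \<open>Because \<open>m \<otimes> x = m x \<otimes> 1\<close>, every element of \<open>M \<odot> \<Theta>(g)\<close> has the form \<open>m \<otimes> 1\<close>, and
  \<^const>\<open>rtwist_can\<close> reads off \<open>m\<close>.\<close>

lemma tensor_Theta_right_eq:
  assumes M: "bimodule S R M" and g: "g \<in> carrier G" and x: "x \<in> carrier (tensor R M (Theta R g))"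
  shows "pure_tensor R M (Theta R g) (rtwist_can M x) \<one>\<^bsub>R\<^esub> = x"
proof -
  interpret M: bimodule S R M by fact
  interpret MT: tensor_pair S R R M "Theta R g"
    using g by (intro tensor_pair.intro bimodule_Theta M)
  have 1: "(\<lambda>m. pure_tensor R M (Theta R g) m \<one>\<^bsub>R\<^esub>) \<in> hom M (tensor R M (Theta R g))"
    by (simp add: hom_def MT.pure_closed MT.pure_add_left)
  have 2: "rtwist_can M \<in> hom (tensor R M (Theta R g)) M"
    using bimod_homD(1) [OF rtwist_can_bimod_hom [OF M g]] by (simp add: hom_def)
  show ?thesis
    using Group.hom_compose [OF 2 1] MT.id_hom_tensor
    by - (rule MT.hom_ext [OF MT.MN.is_group _ _ _ x],
      simp_all add: comp_def rtwist_can_pure [OF M g] MT.pure_balanced)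
qed

text \<open>Every element of \<open>\<Theta>(g\<inverse>) \<odot> M\<close> has the form \<open>1 \<otimes> m\<close>: the right action on \<open>\<Theta>(g\<inverse>)\<close> is twisted by
  \<open>g\<inverse>\<close>, so \<open>a = 1 \<cdot> g(a)\<close> there and \<open>a \<otimes> m = 1 \<otimes> g(a) m\<close>.\<close>

lemma tensor_Theta_left_eq:
  assumes M: "bimodule R S M" and g: "g \<in> carrier G"
    and x: "x \<in> carrier (tensor R (Theta R (inv\<^bsub>G\<^esub> g)) M)"
  shows "pure_tensor R (Theta R (inv\<^bsub>G\<^esub> g)) M \<one>\<^bsub>R\<^esub> (ltwist_can R g M x) = x"
proof -
  let ?T = "Theta R (inv\<^bsub>G\<^esub> g)"
  interpret M: bimodule R S M by fact
  interpret TM: tensor_pair R R S ?T M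
    using g by (intro tensor_pair.intro bimodule_Theta M) simp
  have 1: "(\<lambda>m. pure_tensor R ?T M \<one>\<^bsub>R\<^esub> m) \<in> hom M (tensor R ?T M)"
    by (simp add: hom_def TM.pure_closed TM.pure_add_right)
  have "pure_tensor R ?T M \<one>\<^bsub>R\<^esub> (lact M (act R g a) m) = pure_tensor R ?T M a m"
    if "a \<in> carrier R" "m \<in> carrier M" for a m
    using TM.pure_balanced [of "\<one>\<^bsub>R\<^esub>" "act R g a" m] that g by (simp add: act_inv)
  then show ?thesis
    using Group.hom_compose [OF ltwist_can_hom [OF M g] 1] TM.id_hom_tensor
    by - (rule TM.hom_ext [OF TM.MN.is_group _ _ _ x],
      simp_all add: comp_def ltwist_can_pure [OF M g])
qed

lemma Theta_mult:
  assumes g: "g \<in> carrier G" and h: "h \<in> carrier G"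
  shows Theta_mult_bimod_hom: "Theta_mult R g \<in>
      bimod_hom R R (tensor R (Theta R g) (Theta R h)) (Theta R (g \<otimes>\<^bsub>G\<^esub> h))"
    and Theta_mult_pure: "x \<in> carrier R \<Longrightarrow> y \<in> carrier R \<Longrightarrow>
      Theta_mult R g (pure_tensor R (Theta R g) (Theta R h) x y) = x \<otimes>\<^bsub>R\<^esub> act R g y"
proof -
  interpret TT: tensor_pair R R R "Theta R g" "Theta R h"
    using g h by (intro tensor_pair.intro bimodule_Theta)
  have b: "balanced R (Theta R g) (Theta R h) (add_monoid R) (\<lambda>x y. x \<otimes>\<^bsub>R\<^esub> act R g y)"
    using g h by (intro balancedI)
      (simp_all add: act_add act_mult R.l_distr R.r_distr R.m_assoc)
  note lift = TT.tensor_lift [OF R.a_comm_group b]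
  show pure: "Theta_mult R g (pure_tensor R (Theta R g) (Theta R h) x y) = x \<otimes>\<^bsub>R\<^esub> act R g y"
    if "x \<in> carrier R" "y \<in> carrier R" for x y
    using lift(2) that unfolding Theta_mult_def by simp
  have "Theta_mult R g \<in> hom (tensor R (Theta R g) (Theta R h)) (Theta R (g \<otimes>\<^bsub>G\<^esub> h))"
    using lift(1) by (simp add: Theta_mult_def hom_def)
  then show "Theta_mult R g \<in>
      bimod_hom R R (tensor R (Theta R g) (Theta R h)) (Theta R (g \<otimes>\<^bsub>G\<^esub> h))"
    using g h by (intro TT.bimod_hom_tensorI bimodule_Theta)
      (simp_all add: pure act_mult act_comp R.m_assoc)
qed

end


section \<open>Constraints as group actions\<close>

text \<open>The map \<open>\<phi>\<^sub>g\<close> with \<open>\<tau>\<^sub>g(1 \<otimes> m) = \<phi>\<^sub>g(m) \<otimes> 1\<close>. It determines \<open>\<tau>\<^sub>g\<close>, since the elements \<open>1 \<otimes> m\<close> exhaust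
  \<open>\<Theta>(g) \<odot> M\<close>.\<close>

definition twist_action :: "('g, 'r) gring \<Rightarrow> ('r, 's, 'm) bimod \<Rightarrow> ('g, 'r, 's, 'm) twist \<Rightarrow>
    'g \<Rightarrow> 'm \<Rightarrow> 'm" where
  "twist_action R M \<tau> g m = rtwist_can M (\<tau> g (pure_tensor R (Theta R g) M \<one>\<^bsub>R\<^esub> m))"

locale twisted_bimodule = R: G_ring G R + S: G_ring G S + M: bimodule R S M
  for G :: "('g, 'y) monoid_scheme" and R :: "('g, 'r) gring" and S :: "('g, 's) gring"
    and M :: "('r, 's, 'm) bimod" +
  fixes \<tau> :: "('g, 'r, 's, 'm) twist"
  assumes twist: "twist_1cell G R S M \<tau>"
begin

lemma Theta_pair:
  assumes "g \<in> carrier G"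
  shows Theta_pair_left: "tensor_pair R R S (Theta R g) M"
    and Theta_pair_right: "tensor_pair R S S M (Theta S g)"
  using assms by (auto intro!: tensor_pair.intro M.bimodule_axioms R.bimodule_Theta S.bimodule_Theta)

lemma twist_bimod_hom:
    "g \<in> carrier G \<Longrightarrow> \<tau> g \<in> bimod_hom R S (tensor R (Theta R g) M) (tensor S M (Theta S g))"
  and twist_bij:
    "g \<in> carrier G \<Longrightarrow>
      bij_betw (\<tau> g) (carrier (tensor R (Theta R g) M)) (carrier (tensor S M (Theta S g)))"
  using twist by (simp_all add: twist_1cell_def bimod_iso_def)

abbreviation \<phi> :: "'g \<Rightarrow> 'm \<Rightarrow> 'm" where
  "\<phi> \<equiv> twist_action R M \<tau>"

lemma pure_one_closed:
  assumes "g \<in> carrier G" "m \<in> carrier M"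
  shows "pure_tensor R (Theta R g) M \<one>\<^bsub>R\<^esub> m \<in> carrier (tensor R (Theta R g) M)"
  using tensor_pair.pure_closed [OF Theta_pair_left] assms by simp

lemma twist_pure_one:
  assumes "g \<in> carrier G" "m \<in> carrier M"
  shows "\<tau> g (pure_tensor R (Theta R g) M \<one>\<^bsub>R\<^esub> m) = pure_tensor S M (Theta S g) (\<phi> g m) \<one>\<^bsub>S\<^esub>"
  unfolding twist_action_def
  using S.tensor_Theta_right_eq [OF M.bimodule_axioms] bimod_homD(2) [OF twist_bimod_hom]
    pure_one_closed assms by metis

text \<open>Bilinearity of \<open>\<tau>\<^sub>g\<close>, read on elements. The twist on the left comes from
  \<open>1 \<otimes> r m = g(r) \<otimes> m = g(r) (1 \<otimes> m)\<close> in \<open>\<Theta>(g) \<odot> M\<close>, the one on the right from the right action of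
  \<open>\<Theta>(g)\<close>.\<close>

lemma action_equivariant:
  assumes g: "g \<in> carrier G"
  shows action_closed: "m \<in> carrier M \<Longrightarrow> \<phi> g m \<in> carrier M"
    and action_add: "m \<in> carrier M \<Longrightarrow> m' \<in> carrier M \<Longrightarrow> \<phi> g (m \<otimes>\<^bsub>M\<^esub> m') = \<phi> g m \<otimes>\<^bsub>M\<^esub> \<phi> g m'"
    and action_lact: "r \<in> carrier R \<Longrightarrow> m \<in> carrier M \<Longrightarrow> \<phi> g (lact M r m) = lact M (act R g r) (\<phi> g m)"
    and action_ract: "s \<in> carrier S \<Longrightarrow> m \<in> carrier M \<Longrightarrow> \<phi> g (ract M m s) = ract M (\<phi> g m) (act S g s)"
proof -
  interpret TM: tensor_pair R R S "Theta R g" M by (rule Theta_pair_left [OF g])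
  note t = bimod_homD(2-) [OF twist_bimod_hom [OF g]]
  note c = bimod_homD(2-) [OF S.rtwist_can_bimod_hom [OF M.bimodule_axioms g], simplified]
  note p = TM.pure_closed [simplified]
  show "m \<in> carrier M \<Longrightarrow> \<phi> g m \<in> carrier M"
    by (simp add: twist_action_def t c p)
  show "m \<in> carrier M \<Longrightarrow> m' \<in> carrier M \<Longrightarrow> \<phi> g (m \<otimes>\<^bsub>M\<^esub> m') = \<phi> g m \<otimes>\<^bsub>M\<^esub> \<phi> g m'"
    by (simp add: twist_action_def TM.pure_add_right t c p)
  have "pure_tensor R (Theta R g) M \<one>\<^bsub>R\<^esub> (lact M r m) =
      lact (tensor R (Theta R g) M) (act R g r) (pure_tensor R (Theta R g) M \<one>\<^bsub>R\<^esub> m)"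
    if "r \<in> carrier R" "m \<in> carrier M" for r m
    using TM.pure_balanced [of "\<one>\<^bsub>R\<^esub>" r m] that g by (simp add: TM.lact_pure)
  then show "r \<in> carrier R \<Longrightarrow> m \<in> carrier M \<Longrightarrow> \<phi> g (lact M r m) = lact M (act R g r) (\<phi> g m)"
    by (simp add: twist_action_def t c p g)
  have "pure_tensor R (Theta R g) M \<one>\<^bsub>R\<^esub> (ract M m s) =
      ract (tensor R (Theta R g) M) (pure_tensor R (Theta R g) M \<one>\<^bsub>R\<^esub> m) s"
    if "s \<in> carrier S" "m \<in> carrier M" for s m
    using that by (simp add: TM.ract_pure)
  then show "s \<in> carrier S \<Longrightarrow> m \<in> carrier M \<Longrightarrow> \<phi> g (ract M m s) = ract M (\<phi> g m) (act S g s)"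
    by (simp add: twist_action_def t c p g)
qed

lemma action_one:
  assumes m: "m \<in> carrier M"
  shows "\<phi> \<one>\<^bsub>G\<^esub> m = m"
proof -
  let ?e = "\<one>\<^bsub>G\<^esub>"
  interpret TM: tensor_pair R R S "Theta R ?e" M by (rule Theta_pair_left) simp
  have "balanced R (Theta R ?e) M M (lact M)"
    by (intro balancedI) (simp_all add: M.bimodule_simps R.act_one)
  from TM.tensor_lift_pure [OF M.M.comm_group_axioms this]
  have "lunit M (pure_tensor R (Theta R ?e) M \<one>\<^bsub>R\<^esub> m) = m"
    using m by (simp add: lunit_def M.one_lact)
  moreover have "\<tau> ?e (pure_tensor R (Theta R ?e) M \<one>\<^bsub>R\<^esub> m) =
      rtwist_can_inv S ?e M (lunit M (pure_tensor R (Theta R ?e) M \<one>\<^bsub>R\<^esub> m))"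
    using twist pure_one_closed [OF _ m, of ?e] by (simp add: twist_1cell_def)
  ultimately show ?thesis
    using m by (simp add: twist_action_def rtwist_can_inv_def S.rtwist_can_pure [OF M.bimodule_axioms] M.one_ract)
qed

text \<open>The multiplicativity axiom of a twist, evaluated at \<open>1 \<otimes> (1 \<otimes> m)\<close>. One side is
  \<open>\<tau>(1 \<otimes> m)\<close> at \<open>gh\<close>; on the other side \<open>m\<close> first becomes \<open>\<phi>\<^sub>h(m) \<otimes> 1\<close> and then \<open>(\<phi>\<^sub>g(\<phi>\<^sub>h(m)) \<otimes> 1) \<otimes> 1\<close>.\<close>

lemma action_mult:
  assumes g: "g \<in> carrier G" and h: "h \<in> carrier G" and m: "m \<in> carrier M"
  shows "\<phi> (g \<otimes>\<^bsub>G\<^esub> h) m = \<phi> g (\<phi> h m)"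
proof -
  let ?gh = "g \<otimes>\<^bsub>G\<^esub> h"
  let ?R = "\<lambda>k. Theta R k" and ?S = "\<lambda>k. Theta S k"
  note TR = R.bimodule_Theta and TS = S.bimodule_Theta
  have gh: "?gh \<in> carrier G"
    using g h by simp
  note Mb = M.bimodule_axioms
  note T = tensor_pair.bimodule_tensor [OF tensor_pair.intro]
  note pair = tensor_pair.intro
  let ?p = "\<lambda>k. pure_tensor R (?R k) M \<one>\<^bsub>R\<^esub>"
  let ?x = "pure_tensor R (?R g) (tensor R (?R h) M) \<one>\<^bsub>R\<^esub> (?p h m)"
  have hm: "\<phi> h m \<in> carrier M"
    using action_closed h m by simp
  have x: "?x \<in> carrier (tensor R (?R g) (tensor R (?R h) M))"
    using tensor_pair.pure_closed [OF pair [OF TR [OF g] T [OF TR [OF h] Mb]]] pure_one_closed [OF h m]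
    by simp
  have "tensor_map R (?R ?gh) M (Theta_mult R g) (\<lambda>m. m) (assoc_l R R (?R g) (?R h) M ?x) = ?p ?gh m"
    using m g h
    by (simp add: assoc_l_pure [OF TR [OF g] TR [OF h] Mb]
        tensor_map_bimod_hom(2) [OF pair [OF T [OF TR [OF g] TR [OF h]] Mb] pair [OF TR [OF gh] Mb]
          R.Theta_mult_bimod_hom [OF g h] id_bimod_hom]
        tensor_pair.pure_closed [OF pair [OF TR TR]] R.Theta_mult_pure)
  moreover have "tensor_map R (?R g) (tensor S M (?S h)) (\<lambda>y. y) (\<tau> h) ?x =
      pure_tensor R (?R g) (tensor S M (?S h)) \<one>\<^bsub>R\<^esub> (pure_tensor S M (?S h) (\<phi> h m) \<one>\<^bsub>S\<^esub>)"
    using m g h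
    by (simp add: tensor_map_bimod_hom(2) [OF pair [OF TR [OF g] T [OF TR [OF h] Mb]]
          pair [OF TR [OF g] T [OF Mb TS [OF h]]] id_bimod_hom twist_bimod_hom [OF h]]
        pure_one_closed twist_pure_one)
  moreover have "assoc_l R S (?R g) M (?S h) \<dots> =
      pure_tensor S (tensor R (?R g) M) (?S h) (?p g (\<phi> h m)) \<one>\<^bsub>S\<^esub>"
    using hm by (simp add: assoc_l_pure [OF TR [OF g] Mb TS [OF h]])
  moreover have "tensor_map S (tensor S M (?S g)) (?S h) (\<tau> g) (\<lambda>y. y) \<dots> =
      pure_tensor S (tensor S M (?S g)) (?S h) (pure_tensor S M (?S g) (\<phi> g (\<phi> h m)) \<one>\<^bsub>S\<^esub>) \<one>\<^bsub>S\<^esub>"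
    using hm g h
    by (simp add: tensor_map_bimod_hom(2) [OF pair [OF T [OF TR [OF g] Mb] TS [OF h]]
          pair [OF T [OF Mb TS [OF g]] TS [OF h]] twist_bimod_hom [OF g] id_bimod_hom]
        pure_one_closed twist_pure_one)
  moreover have "assoc_r S S M (?S g) (?S h) \<dots> =
      pure_tensor S M (tensor S (?S g) (?S h)) (\<phi> g (\<phi> h m)) (pure_tensor S (?S g) (?S h) \<one>\<^bsub>S\<^esub> \<one>\<^bsub>S\<^esub>)"
    using action_closed [OF g hm] by (simp add: assoc_r_pure [OF Mb TS [OF g] TS [OF h]])
  moreover have "tensor_map S M (?S ?gh) (\<lambda>m. m) (Theta_mult S g) \<dots> =
      pure_tensor S M (?S ?gh) (\<phi> g (\<phi> h m)) \<one>\<^bsub>S\<^esub>"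
    using action_closed [OF g hm] g h
    by (simp add: tensor_map_bimod_hom(2) [OF pair [OF Mb T [OF TS [OF g] TS [OF h]]]
          pair [OF Mb TS [OF gh]] id_bimod_hom S.Theta_mult_bimod_hom [OF g h]]
        tensor_pair.pure_closed [OF pair [OF TS TS]] S.Theta_mult_pure)
  ultimately have "\<tau> ?gh (?p ?gh m) = pure_tensor S M (?S ?gh) (\<phi> g (\<phi> h m)) \<one>\<^bsub>S\<^esub>"
    using twist g h x unfolding twist_1cell_def by metis
  then show ?thesis
    using action_closed [OF g hm] gh
    by (simp add: twist_action_def [of _ _ _ ?gh] S.rtwist_can_pure [OF Mb] M.one_ract)
qed

text \<open>All canonical identifications in the definition of \<open>\<gamma>\<^sub>g\<close> only insert or absorb the unit elements
  \<open>1 \<in> R\<close> and \<open>1 \<in> S\<close>, which the ring automorphisms fix.\<close>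

lemma bitwist_eq_action:
  assumes g: "g \<in> carrier G" and m: "m \<in> carrier M"
  shows "bitwist G R S M \<tau> g m = \<phi> g m"
proof -
  note pair = tensor_pair.intro
  let ?T = "Theta R (inv\<^bsub>G\<^esub> g)"
  have T: "bimodule R R ?T"
    using g by (intro R.bimodule_Theta) simp
  note X = tensor_pair.bimodule_tensor [OF Theta_pair_left [OF g]]
  note Y = tensor_pair.bimodule_tensor [OF Theta_pair_right [OF g]]
  let ?x = "pure_tensor R (Theta R g) M \<one>\<^bsub>R\<^esub> m"
  have 1: "\<tau> g ?x \<in> carrier (tensor S M (Theta S g))"
    using bimod_homD(2) [OF twist_bimod_hom [OF g]] pure_one_closed [OF g m] .
  have "tensor_map R ?T (tensor S M (Theta S g)) (\<lambda>x. x) (\<tau> g)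
      (pure_tensor R ?T (tensor R (Theta R g) M) \<one>\<^bsub>R\<^esub> ?x) =
    pure_tensor R ?T (tensor S M (Theta S g)) \<one>\<^bsub>R\<^esub> (\<tau> g ?x)"
    using pure_one_closed [OF g m]
    by (simp add: tensor_map_bimod_hom(2) [OF pair [OF T X] pair [OF T Y] id_bimod_hom twist_bimod_hom [OF g]])
  then show ?thesis
    using 1 g by (simp add: bitwist_def twist_action_def R.ltwist_can_pure [OF Y g] bimodule.one_lact [OF Y])
qed

text \<open>Write the preimage of \<open>m \<otimes> 1\<close> under \<open>\<tau>\<close> at \<open>g\<inverse>\<close> as \<open>1 \<otimes> n\<close>. Then \<open>n\<close> is the transport of \<open>m\<close>, and
  \<open>\<phi>(n) = m\<close> at \<open>g\<inverse>\<close>; applying \<open>\<phi>\<^sub>g\<close> gives \<open>n = \<phi>\<^sub>g(m)\<close>.\<close>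

lemma transport_eq_action:
  assumes g: "g \<in> carrier G" and m: "m \<in> carrier M"
  shows "transport G R S M \<tau> g m = \<phi> g m"
proof -
  let ?h = "inv\<^bsub>G\<^esub> g"
  have h: "?h \<in> carrier G"
    using g by simp
  let ?T = "tensor R (Theta R ?h) M"
  define x where "x = inv_into (carrier ?T) (\<tau> ?h) (rtwist_can_inv S ?h M m)"
  have "rtwist_can_inv S ?h M m \<in> carrier (tensor S M (Theta S ?h))"
    unfolding rtwist_can_inv_def using tensor_pair.pure_closed [OF Theta_pair_right [OF h]] m by simp
  then have "rtwist_can_inv S ?h M m \<in> \<tau> ?h ` carrier ?T"
    using twist_bij [OF h] by (simp add: bij_betw_def)
  then have x: "x \<in> carrier ?T" "\<tau> ?h x = rtwist_can_inv S ?h M m"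
    unfolding x_def by (rule inv_into_into, rule f_inv_into_f)
  define n where "n = ltwist_can R g M x"
  have n: "n \<in> carrier M"
    unfolding n_def using hom_in_carrier [OF R.ltwist_can_hom [OF M.bimodule_axioms g]] x(1) by blast
  have "pure_tensor R (Theta R ?h) M \<one>\<^bsub>R\<^esub> n = x"
    unfolding n_def by (rule R.tensor_Theta_left_eq [OF M.bimodule_axioms g x(1)])
  then have "\<phi> ?h n = m"
    using x(2) m h
    by (simp add: twist_action_def rtwist_can_inv_def S.rtwist_can_pure [OF M.bimodule_axioms] M.one_ract)
  then have "\<phi> g m = n"
    using action_mult [OF g h n] action_one [OF n] g by simp
  then show ?thesis
    by (simp add: transport_def n_def x_def)
qed

end

section \<open>Shadows\<close>

context
  fixes R :: "('r, 'x) ring_scheme" and M :: "('r, 'r, 'm) bimod"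
  assumes M: "bimodule R R M"
begin

interpretation M: bimodule R R M by (rule M)

private abbreviation rel :: "'m set" where
  "rel \<equiv> {lact M r m \<otimes>\<^bsub>M\<^esub> inv\<^bsub>M\<^esub> (ract M m r) | r m. r \<in> carrier R \<and> m \<in> carrier M}"

private lemma rel_carrier: "rel \<subseteq> carrier M"
  by (auto simp: M.lact_closed M.ract_closed)

lemma comm_group_HH0: "comm_group (HH0 R M)"
  unfolding HH0_def HH0_ker_def by (rule M.M.comm_group_Mod_generate [OF rel_carrier])

lemma HH0_class_hom: "HH0_class R M \<in> hom M (HH0 R M)"
  using M.M.hom_Mod_generate [OF rel_carrier]
  by (simp add: HH0_class_def [abs_def] HH0_def HH0_ker_def)

lemma HH0_class_eq:
  "r \<in> carrier R \<Longrightarrow> m \<in> carrier M \<Longrightarrow> HH0_class R M (lact M r m) = HH0_class R M (ract M m r)"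
  unfolding HH0_class_def HH0_ker_def
  by (rule M.M.Mod_generate_eq [OF rel_carrier]) (auto simp: M.lact_closed M.ract_closed)

lemma
  assumes A: "group A" and h: "h \<in> hom M A"
    and eq: "\<And>r m. r \<in> carrier R \<Longrightarrow> m \<in> carrier M \<Longrightarrow> h (lact M r m) = h (ract M m r)"
  shows HH0_lift_hom: "(\<lambda>X. the_elem (h ` X)) \<in> hom (HH0 R M) A"
    and HH0_lift_class: "m \<in> carrier M \<Longrightarrow> the_elem (h ` HH0_class R M m) = h m"
proof -
  interpret h: group_hom M A h
    using A h M.M.is_group by (simp add: group_hom_def group_hom_axioms_def)
  have "h x = \<one>\<^bsub>A\<^esub>" if "x \<in> rel" for x
    using that by (auto simp: eq M.lact_closed M.ract_closed)
  note lift = M.M.the_elem_image_coset [OF rel_carrier A h this]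
  show "(\<lambda>X. the_elem (h ` X)) \<in> hom (HH0 R M) A"
    unfolding HH0_def HH0_ker_def by (rule lift(2))
  show "m \<in> carrier M \<Longrightarrow> the_elem (h ` HH0_class R M m) = h m"
    unfolding HH0_class_def HH0_ker_def by (rule lift(1))
qed

end

lemma
  assumes M: "bimodule R R M" and N: "bimodule R R N" and f: "f \<in> bimod_hom R R M N"
  shows HH0_map_hom: "HH0_map R N f \<in> hom (HH0 R M) (HH0 R N)"
    and HH0_map_class: "m \<in> carrier M \<Longrightarrow> HH0_map R N f (HH0_class R M m) = HH0_class R N (f m)"
proof -
  have h: "(\<lambda>m. HH0_class R N (f m)) \<in> hom M (HH0 R N)"
    using Group.hom_compose [OF bimod_homD(1) [OF f] HH0_class_hom [OF N]] by (simp add: comp_def)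
  have A: "group (HH0 R N)"
    using comm_group_HH0 [OF N] by (simp add: comm_group_def)
  have eq: "HH0_class R N (f (lact M r m)) = HH0_class R N (f (ract M m r))"
    if "r \<in> carrier R" "m \<in> carrier M" for r m
    using that by (simp add: bimod_homD [OF f] HH0_class_eq [OF N])
  show "HH0_map R N f \<in> hom (HH0 R M) (HH0 R N)"
    using HH0_lift_hom [OF M A h eq] by (simp add: HH0_map_def [abs_def])
  show "m \<in> carrier M \<Longrightarrow> HH0_map R N f (HH0_class R M m) = HH0_class R N (f m)"
    using HH0_lift_class [OF M A h eq] by (simp add: HH0_map_def)
qed

text \<open>The two quotients trade places: \<open>m \<otimes> n \<mapsto> [n \<otimes> m]\<close> is balanced over \<open>S\<close> by the relations of the target
  shadow, and it respects those of the source shadow because \<open>N \<odot> M\<close> is formed over \<open>R\<close>.\<close>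

lemma
  assumes M: "bimodule R S M" and N: "bimodule S R N"
  shows cyc_hom: "cyc R S M N \<in> hom (HH0 R (tensor S M N)) (HH0 S (tensor R N M))"
    and cyc_class_pure: "m \<in> carrier M \<Longrightarrow> n \<in> carrier N \<Longrightarrow>
      cyc R S M N (HH0_class R (tensor S M N) (pure_tensor S M N m n)) =
        HH0_class S (tensor R N M) (pure_tensor R N M n m)"
proof -
  interpret M: bimodule R S M by fact
  interpret N: bimodule S R N by fact
  interpret MN: tensor_pair R S R M N using M N by (rule tensor_pair.intro)
  interpret NM: tensor_pair S R S N M using N M by (rule tensor_pair.intro)
  let ?A = "HH0 S (tensor R N M)" and ?c = "HH0_class S (tensor R N M)"
  note c = HH0_class_hom [OF NM.bimodule_tensor] and eq = HH0_class_eq [OF NM.bimodule_tensor]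
  have A: "comm_group ?A"
    by (rule comm_group_HH0 [OF NM.bimodule_tensor])
  then have gA: "group ?A"
    by (simp add: comm_group_def)
  have "?c (pure_tensor R N M n (ract M m s)) = ?c (pure_tensor R N M (lact N s n) m)"
    if "m \<in> carrier M" "s \<in> carrier S" "n \<in> carrier N" for m s n
    using that eq [of s "pure_tensor R N M n m"] by (simp add: NM.pure_closed NM.lact_pure NM.ract_pure)
  then have b: "balanced S M N ?A (\<lambda>m n. ?c (pure_tensor R N M n m))"
    by (intro balancedI) (simp_all add: hom_in_carrier [OF c] hom_mult [OF c] NM.pure_closed
        NM.pure_add_left NM.pure_add_right)
  note lift = MN.tensor_lift [OF A b]
  let ?h = "tensor_lift ?A (\<lambda>m n. ?c (pure_tensor R N M n m))"
  have "?c (pure_tensor R N M n (lact M r m)) = ?c (pure_tensor R N M (ract N n r) m)"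
    if "m \<in> carrier M" "r \<in> carrier R" "n \<in> carrier N" for m r n
    using that by (simp add: NM.pure_balanced)
  then have heq: "?h (lact (tensor S M N) r x) = ?h (ract (tensor S M N) x r)"
    if "r \<in> carrier R" and x: "x \<in> carrier (tensor S M N)" for r x
    using that(1) Group.hom_compose [OF MN.lact_tensor_hom lift(1), of r]
      Group.hom_compose [OF MN.ract_tensor_hom lift(1), of r]
    by - (rule MN.hom_ext [OF gA _ _ _ x], simp_all add: comp_def MN.lact_pure MN.ract_pure
      lift(2) M.lact_closed N.ract_closed)
  show "cyc R S M N \<in> hom (HH0 R (tensor S M N)) (HH0 S (tensor R N M))"
    using HH0_lift_hom [OF MN.bimodule_tensor gA lift(1) heq] by (simp add: cyc_def [abs_def])
  show "m \<in> carrier M \<Longrightarrow> n \<in> carrier N \<Longrightarrow>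
      cyc R S M N (HH0_class R (tensor S M N) (pure_tensor S M N m n)) =
        ?c (pure_tensor R N M n m)"
    using HH0_lift_class [OF MN.bimodule_tensor gA lift(1) heq, of "pure_tensor S M N m n"]
    by (simp add: cyc_def lift(2) MN.pure_closed)
qed

text \<open>The left action of the first factor enters neither the relations of the tensor product nor the
  underlying group, so left twisting commutes with tensoring on the nose.\<close>

lemma pure_tensor_ltwist: "pure_tensor S (ltwist R g M) N = pure_tensor S M N"
  by (simp add: pure_tensor_def [abs_def] tensor_ker_def tensor_rel_def)

lemma ltwist_tensor: "ltwist R g (tensor S M N) = tensor S (ltwist R g M) N"
  by (simp add: tensor_def tensor_group_def tensor_ker_def tensor_rel_def ltwist_def
      pure_tensor_def [abs_def])

lemma (in G_ring) bimod_hom_ltwist: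
  assumes "f \<in> bimod_hom R S M N" "g \<in> carrier G"
  shows "f \<in> bimod_hom R S (ltwist R g M) (ltwist R g N)"
  using assms(2) bimod_homD [OF assms(1)] by (intro bimod_homI) simp_all

text \<open>On pure tensors the three steps are \<open>n \<otimes> m \<mapsto> m \<otimes> n \<mapsto> m \<otimes> n \<mapsto> \<phi>\<^sub>g(m) \<otimes> n\<close>. The middle step moves
  the twist of the \<open>S\<close>-action from \<open>N\<close> to \<open>M\<close>: it is balanced because
  \<open>m s \<otimes> n = m g\<inverse>(g(s)) \<otimes> n\<close> becomes \<open>m \<otimes> g(s) n\<close>.\<close>

lemma (in twisted_bimodule) twisted_cyc:
  assumes N: "bimodule S R N" and g: "g \<in> carrier G"
  shows twisted_cyc_hom: "twisted_cyc G S R g N M \<tau> \<in>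
      hom (twisted_HH0 S g (tensor R N M)) (twisted_HH0 R g (tensor S M N))"
    and twisted_cyc_class_pure: "n \<in> carrier N \<Longrightarrow> m \<in> carrier M \<Longrightarrow>
      twisted_cyc G S R g N M \<tau> (twisted_HH0_class S g (tensor R N M) (pure_tensor R N M n m)) =
        twisted_HH0_class R g (tensor S M N) (pure_tensor S M N (\<phi> g m) n)"
proof -
  interpret N: bimodule S R N by fact
  note Mb = M.bimodule_axioms
  have g': "inv\<^bsub>G\<^esub> g \<in> carrier G"
    using g by simp
  let ?gN = "ltwist S g N" and ?Mg = "rtwist S (inv\<^bsub>G\<^esub> g) M" and ?gM = "ltwist R g M"
  have gN: "bimodule S R ?gN" by (rule S.bimodule_ltwist [OF N g])
  have Mg: "bimodule R S ?Mg" by (rule S.bimodule_rtwist [OF Mb g'])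
  have gM: "bimodule R S ?gM" by (rule R.bimodule_ltwist [OF Mb g])
  note pair = tensor_pair.intro
  interpret A: tensor_pair R S R M ?gN by (rule pair [OF Mb gN])
  interpret B: tensor_pair R S R ?Mg N by (rule pair [OF Mg N])
  interpret C: tensor_pair R S R ?gM N by (rule pair [OF gM N])
  let ?t = "transport G R S M \<tau> g"
  let ?i = "tensor_map S ?Mg N (\<lambda>n. n) (\<lambda>m. m)" and ?j = "tensor_map S ?gM N ?t (\<lambda>m. m)"
  have bal: "pure_tensor S ?Mg N (ract M m s) n = pure_tensor S ?Mg N m (lact ?gN s n)"
    if "m \<in> carrier M" "s \<in> carrier S" "n \<in> carrier N" for m s n
    using B.pure_balanced [of m "act S g s" n] that g by (simp add: S.act_inv)
  have id: "(\<lambda>n. n) \<in> hom M ?Mg" "(\<lambda>n. n) \<in> hom ?gN N"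
    by (simp_all add: hom_def)
  have i_hom: "?i \<in> hom (tensor S M ?gN) (tensor S ?Mg N)"
    using bal by (intro tensor_map_hom [OF A.tensor_pair_axioms B.tensor_pair_axioms id]) simp_all
  have i_pure: "?i (pure_tensor S M ?gN m n) = pure_tensor S ?Mg N m n"
    if "m \<in> carrier M" "n \<in> carrier N" for m n
    using that bal by (intro tensor_map_pure [OF A.tensor_pair_axioms B.tensor_pair_axioms id]) simp_all
  have i: "?i \<in> bimod_hom R R (tensor S M ?gN) (tensor S ?Mg N)"
    by (intro A.bimod_hom_tensorI B.bimodule_tensor i_hom)
      (simp_all add: i_pure M.lact_closed N.ract_closed B.lact_pure B.ract_pure)
  have t: "?t \<in> bimod_hom R S ?Mg ?gM"
    using g by (intro bimod_homI)
      (simp_all add: transport_eq_action action_closed action_add action_lact action_ract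
        M.lact_closed M.ract_closed S.act_inv)
  note j = tensor_map_bimod_hom [OF B.tensor_pair_axioms C.tensor_pair_axioms t id_bimod_hom]
  note 1 = cyc_hom [OF gN Mb] and 2 = HH0_map_hom [OF A.bimodule_tensor B.bimodule_tensor i]
    and 3 = HH0_map_hom [OF B.bimodule_tensor C.bimodule_tensor j(1)]
  show "twisted_cyc G S R g N M \<tau> \<in>
      hom (twisted_HH0 S g (tensor R N M)) (twisted_HH0 R g (tensor S M N))"
    using Group.hom_compose [OF Group.hom_compose [OF 1 2] 3]
    by (simp add: twisted_cyc_def [abs_def] ltwist_tensor comp_def)
  show "twisted_cyc G S R g N M \<tau> (twisted_HH0_class S g (tensor R N M) (pure_tensor R N M n m)) =
      twisted_HH0_class R g (tensor S M N) (pure_tensor S M N (\<phi> g m) n)"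
    if "n \<in> carrier N" "m \<in> carrier M"
    using that cyc_class_pure [OF gN Mb, of n m] g
      HH0_map_class [OF A.bimodule_tensor B.bimodule_tensor i, of "pure_tensor S M ?gN m n"]
      HH0_map_class [OF B.bimodule_tensor C.bimodule_tensor j(1), of "pure_tensor S ?Mg N m n"]
    by (simp add: twisted_cyc_def ltwist_tensor pure_tensor_ltwist A.pure_closed B.pure_closed i_pure j(2)
        transport_eq_action)
qed


section \<open>Modules of homomorphisms\<close>

lemma lHom_simps [simp]:
  "\<xi> \<otimes>\<^bsub>lHom R M N\<^esub> \<zeta> = (\<lambda>m \<in> carrier M. \<xi> m \<otimes>\<^bsub>N\<^esub> \<zeta> m)"
  "\<one>\<^bsub>lHom R M N\<^esub> = (\<lambda>m \<in> carrier M. \<one>\<^bsub>N\<^esub>)"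
  "lact (lHom R M N) s \<xi> = (\<lambda>m \<in> carrier M. \<xi> (ract M m s))"
  "ract (lHom R M N) \<xi> t = (\<lambda>m \<in> carrier M. ract N (\<xi> m) t)"
  by (simp_all add: lHom_def)

lemma lHomD:
  assumes "\<xi> \<in> carrier (lHom R M N)"
  shows "m \<in> carrier M \<Longrightarrow> \<xi> m \<in> carrier N"
    and "m \<in> carrier M \<Longrightarrow> m' \<in> carrier M \<Longrightarrow> \<xi> (m \<otimes>\<^bsub>M\<^esub> m') = \<xi> m \<otimes>\<^bsub>N\<^esub> \<xi> m'"
    and "r \<in> carrier R \<Longrightarrow> m \<in> carrier M \<Longrightarrow> \<xi> (lact M r m) = lact N r (\<xi> m)"
    and "\<xi> \<in> extensional (carrier M)"
  using assms by (auto simp: lHom_def hom_def)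

lemma lHomI:
  assumes "\<And>m. m \<in> carrier M \<Longrightarrow> \<xi> m \<in> carrier N"
    and "\<And>m m'. m \<in> carrier M \<Longrightarrow> m' \<in> carrier M \<Longrightarrow> \<xi> (m \<otimes>\<^bsub>M\<^esub> m') = \<xi> m \<otimes>\<^bsub>N\<^esub> \<xi> m'"
    and "\<And>r m. r \<in> carrier R \<Longrightarrow> m \<in> carrier M \<Longrightarrow> \<xi> (lact M r m) = lact N r (\<xi> m)"
    and "\<xi> \<in> extensional (carrier M)"
  shows "\<xi> \<in> carrier (lHom R M N)"
  using assms by (auto simp: lHom_def hom_def)

lemma lHom_eqI:
  assumes "\<xi> \<in> carrier (lHom R M N)" "\<zeta> \<in> carrier (lHom R M N)"
    and "\<And>m. m \<in> carrier M \<Longrightarrow> \<xi> m = \<zeta> m"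
  shows "\<xi> = \<zeta>"
  using extensionalityI [OF lHomD(4) [OF assms(1)] lHomD(4) [OF assms(2)]] assms(3) by blast

lemma bimodule_lHom:
  assumes M: "bimodule R S M" and N: "bimodule R T N"
  shows "bimodule S T (lHom R M N)"
proof -
  interpret M: bimodule R S M by fact
  interpret N: bimodule R T N by fact
  note [simp] = lHomD(1-3) M.bimodule_simps N.bimodule_simps
  have mult: "(\<lambda>m \<in> carrier M. \<xi> m \<otimes>\<^bsub>N\<^esub> \<zeta> m) \<in> carrier (lHom R M N)"
    if "\<xi> \<in> carrier (lHom R M N)" "\<zeta> \<in> carrier (lHom R M N)" for \<xi> \<zeta>
    using that by (intro lHomI) (simp_all add: N.M.m_ac)
  have one: "(\<lambda>m \<in> carrier M. \<one>\<^bsub>N\<^esub>) \<in> carrier (lHom R M N)"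
    using hom_one [OF N.lact_hom N.M.is_group N.M.is_group] by (intro lHomI) simp_all
  have inv: "(\<lambda>m \<in> carrier M. inv\<^bsub>N\<^esub> \<xi> m) \<in> carrier (lHom R M N)"
    if "\<xi> \<in> carrier (lHom R M N)" for \<xi>
  proof -
    have "lact N r (inv\<^bsub>N\<^esub> n) = inv\<^bsub>N\<^esub> lact N r n" if "r \<in> carrier R" "n \<in> carrier N" for r n
      using group_hom.hom_inv [of N N "lact N r" n] that N.lact_hom N.M.is_group
      by (simp add: group_hom_def group_hom_axioms_def)
    then show ?thesis
      using that by (intro lHomI) (simp_all add: N.M.inv_mult)
  qed
  have comm: "comm_group (lHom R M N)"
  proof (rule comm_groupI)
    fix \<xi> assume "\<xi> \<in> carrier (lHom R M N)"
    then show "\<exists>\<zeta> \<in> carrier (lHom R M N). \<zeta> \<otimes>\<^bsub>lHom R M N\<^esub> \<xi> = \<one>\<^bsub>lHom R M N\<^esub>"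
      by (intro bexI [OF _ inv]) (auto simp: restrict_def)
  next
    fix \<xi> assume "\<xi> \<in> carrier (lHom R M N)"
    with mult [OF one this] show "\<one>\<^bsub>lHom R M N\<^esub> \<otimes>\<^bsub>lHom R M N\<^esub> \<xi> = \<xi>"
      by (intro lHom_eqI [of _ R M N]) (simp_all only: lHom_simps, simp)
  qed (auto simp: mult one N.M.m_ac intro!: restrict_ext)
  have l: "(\<lambda>m \<in> carrier M. \<xi> (ract M m s)) \<in> carrier (lHom R M N)"
    if "\<xi> \<in> carrier (lHom R M N)" "s \<in> carrier S" for \<xi> s
    using that by (intro lHomI) simp_all
  have r: "(\<lambda>m \<in> carrier M. ract N (\<xi> m) t) \<in> carrier (lHom R M N)"
    if "\<xi> \<in> carrier (lHom R M N)" "t \<in> carrier T" for \<xi> t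
    using that by (intro lHomI) simp_all
  show ?thesis
  proof (intro bimodule.intro bimodule_axioms.intro comm bimodule.axioms(2) [OF M] bimodule.axioms(2) [OF N])
    fix \<xi> assume "\<xi> \<in> carrier (lHom R M N)"
    then show "lact (lHom R M N) \<one>\<^bsub>S\<^esub> \<xi> = \<xi>" "ract (lHom R M N) \<xi> \<one>\<^bsub>T\<^esub> = \<xi>"
      using l r by (auto intro!: lHom_eqI [of _ R M N])
  qed (auto simp: l r intro!: restrict_ext)
qed


section \<open>Twisted traces of a dual pair\<close>

locale twisted_dual_pair = twisted_bimodule G R S P \<tau> + D: bimodule S R D
  for G :: "('g, 'y) monoid_scheme" and R :: "('g, 'r) gring" and S :: "('g, 's) gring"
    and P :: "('r, 's, 'p) bimod" and \<tau> :: "('g, 'r, 's, 'p) twist" and D :: "('s, 'r, 'd) bimod" +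
  fixes \<eta> :: "'s \<Rightarrow> ('d, 'p) tens" and \<epsilon> :: "('p, 'd) tens \<Rightarrow> 'r" and g :: 'g
  assumes eta: "\<eta> \<in> bimod_hom S S (unit_bimod S) (tensor R D P)"
    and eps: "\<epsilon> \<in> bimod_hom R R (tensor S P D) (unit_bimod R)"
    and triangle: "p \<in> carrier P \<Longrightarrow>
      lunit P (tensor_map R (unit_bimod R) P \<epsilon> (\<lambda>q. q)
        (assoc_l S R P D P
          (tensor_map S P (tensor R D P) (\<lambda>q. q) \<eta> (runit_inv S P p)))) = p"
    and g: "g \<in> carrier G"
begin

sublocale DP: tensor_pair S R S D P
  by (intro tensor_pair.intro D.bimodule_axioms M.bimodule_axioms)

sublocale PD: tensor_pair R S R P D
  by (intro tensor_pair.intro D.bimodule_axioms M.bimodule_axioms)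

text \<open>The homomorphism \<open>\<Sum> d\<^sub>i \<otimes> p\<^sub>i \<mapsto> \<Sum> \<epsilon>(p \<otimes> d\<^sub>i) p\<^sub>i\<close>, presented as the tail of the composite in the triangle
  identity. That identity thus reads \<open>contract p coev = p\<close>: the coevaluation is a dual basis.\<close>

definition contract :: "'p \<Rightarrow> ('d, 'p) tens \<Rightarrow> 'p" where
  "contract p x = lunit P (tensor_map R (unit_bimod R) P \<epsilon> (\<lambda>q. q)
     (assoc_l S R P D P (pure_tensor S P (tensor R D P) p x)))"

abbreviation ev :: "'p \<Rightarrow> 'd \<Rightarrow> 'r" where
  "ev p d \<equiv> \<epsilon> (pure_tensor S P D p d)"

abbreviation coev :: "('d, 'p) tens" where
  "coev \<equiv> \<eta> \<one>\<^bsub>S\<^esub>"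

abbreviation twisted_class :: "'r \<Rightarrow> 'r set" where
  "twisted_class \<equiv> twisted_HH0_class R g (unit_bimod R)"

lemma ev:
  assumes "p \<in> carrier P" "d \<in> carrier D"
  shows ev_closed: "ev p d \<in> carrier R"
    and ev_add_left: "p' \<in> carrier P \<Longrightarrow> ev (p \<otimes>\<^bsub>P\<^esub> p') d = ev p d \<oplus>\<^bsub>R\<^esub> ev p' d"
    and ev_add_right: "d' \<in> carrier D \<Longrightarrow> ev p (d \<otimes>\<^bsub>D\<^esub> d') = ev p d \<oplus>\<^bsub>R\<^esub> ev p d'"
    and ev_balanced: "s \<in> carrier S \<Longrightarrow> ev (ract P p s) d = ev p (lact D s d)"
    and ev_lact: "r \<in> carrier R \<Longrightarrow> ev (lact P r p) d = r \<otimes>\<^bsub>R\<^esub> ev p d"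
    and ev_ract: "r \<in> carrier R \<Longrightarrow> ev p (ract D d r) = ev p d \<otimes>\<^bsub>R\<^esub> r"
  using assms bimod_homD [OF eps] PD.pure_closed PD.pure_add_left PD.pure_add_right PD.pure_balanced
  by (simp_all flip: PD.lact_pure PD.ract_pure)

lemma coev_closed: "coev \<in> carrier (tensor R D P)"
  using bimod_homD(2) [OF eta] by simp

lemma coev_ract: "s \<in> carrier S \<Longrightarrow> \<eta> s = ract (tensor R D P) coev s"
  using bimod_homD(5) [OF eta, of s "\<one>\<^bsub>S\<^esub>"] by simp

lemma
  assumes p: "p \<in> carrier P"
  shows contract_hom: "contract p \<in> hom (tensor R D P) P"
    and contract_pure: "d \<in> carrier D \<Longrightarrow> q \<in> carrier P \<Longrightarrow>
      contract p (pure_tensor R D P d q) = lact P (ev p d) q"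
    and contract_coev: "contract p coev = p"
proof -
  note pair = tensor_pair.intro
  note U = R.R.bimodule_unit_bimod and U' = S.R.bimodule_unit_bimod and Pb = M.bimodule_axioms
  interpret P_DP: tensor_pair R S S P "tensor R D P"
    by (rule pair [OF Pb DP.bimodule_tensor])
  interpret PD_P: tensor_pair R R S "tensor S P D" P
    by (rule pair [OF PD.bimodule_tensor Pb])
  interpret UP: tensor_pair R R S "unit_bimod R" P
    by (rule pair [OF U Pb])
  note m = tensor_map_bimod_hom [OF PD_P.tensor_pair_axioms UP.tensor_pair_axioms eps id_bimod_hom]
  have 1: "pure_tensor S P (tensor R D P) p \<in> hom (tensor R D P) (tensor S P (tensor R D P))"
    using p by (simp add: hom_def P_DP.pure_closed P_DP.pure_add_right)
  show "contract p \<in> hom (tensor R D P) P"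
    using Group.hom_compose [OF Group.hom_compose [OF Group.hom_compose [OF 1 assoc_l_hom
        [OF Pb D.bimodule_axioms Pb]] bimod_homD(1) [OF m(1)]] M.lunit_hom]
    by (simp add: contract_def [abs_def] comp_def)
  show "contract p (pure_tensor R D P d q) = lact P (ev p d) q"
    if "d \<in> carrier D" "q \<in> carrier P"
    using that p by (simp add: contract_def assoc_l_pure [OF Pb D.bimodule_axioms Pb] m(2)
        PD.pure_closed M.lunit_pure ev_closed)
  have "tensor_map S P (tensor R D P) (\<lambda>q. q) \<eta> (runit_inv S P p) = pure_tensor S P (tensor R D P) p coev"
    unfolding runit_inv_def using p
    by (simp add: tensor_map_bimod_hom(2) [OF pair [OF Pb U'] P_DP.tensor_pair_axioms id_bimod_hom eta])
  then show "contract p coev = p"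
    using triangle [OF p] by (simp add: contract_def)
qed

definition ev_hom :: "'d \<Rightarrow> 'p \<Rightarrow> 'r" where
  "ev_hom d = (\<lambda>p \<in> carrier P. ev p d)"

lemma ev_hom:
  assumes "d \<in> carrier D"
  shows ev_hom_closed: "ev_hom d \<in> carrier (ldual R P)"
    and ev_hom_add: "d' \<in> carrier D \<Longrightarrow> ev_hom (d \<otimes>\<^bsub>D\<^esub> d') = ev_hom d \<otimes>\<^bsub>ldual R P\<^esub> ev_hom d'"
    and ev_hom_ract: "r \<in> carrier R \<Longrightarrow> ev_hom (ract D d r) = ract (ldual R P) (ev_hom d) r"
  using assms by (auto simp: ev_hom_def ev M.lact_closed intro!: lHomI restrict_ext)

lemma bimodule_twisted_unit: "bimodule R R (ltwist R g (unit_bimod R))"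
  by (rule R.bimodule_ltwist [OF R.R.bimodule_unit_bimod g])

lemma comm_group_twisted_HH0: "comm_group (twisted_HH0 R g (unit_bimod R))"
  by (rule comm_group_HH0 [OF bimodule_twisted_unit])

lemma twisted_class:
  shows twisted_class_closed: "r \<in> carrier R \<Longrightarrow> twisted_class r \<in> carrier (twisted_HH0 R g (unit_bimod R))"
    and twisted_class_add: "r \<in> carrier R \<Longrightarrow> r' \<in> carrier R \<Longrightarrow>
      twisted_class (r \<oplus>\<^bsub>R\<^esub> r') = twisted_class r \<otimes>\<^bsub>twisted_HH0 R g (unit_bimod R)\<^esub> twisted_class r'"
    and twisted_class_eq: "r \<in> carrier R \<Longrightarrow> r' \<in> carrier R \<Longrightarrow>
      twisted_class (act R g r' \<otimes>\<^bsub>R\<^esub> r) = twisted_class (r \<otimes>\<^bsub>R\<^esub> r')"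
  using hom_in_carrier [OF HH0_class_hom [OF bimodule_twisted_unit], of r]
    hom_mult [OF HH0_class_hom [OF bimodule_twisted_unit], of r r']
    HH0_class_eq [OF bimodule_twisted_unit, of r' r]
  by simp_all

text \<open>The left \<open>R\<close>-linear maps from \<open>P\<close> to \<open>\<^sup>gP\<close>, as maps on the group \<open>P\<close> whose values outside the carrier
  are arbitrary.\<close>

definition semilinear :: "('p \<Rightarrow> 'p) \<Rightarrow> bool" where
  "semilinear \<psi> \<longleftrightarrow> \<psi> \<in> hom P P \<and>
     (\<forall>r \<in> carrier R. \<forall>p \<in> carrier P. \<psi> (lact P r p) = lact P (act R g r) (\<psi> p))"

lemma semilinearD:
  assumes "semilinear \<psi>"
  shows "p \<in> carrier P \<Longrightarrow> \<psi> p \<in> carrier P"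
    and "p \<in> carrier P \<Longrightarrow> p' \<in> carrier P \<Longrightarrow> \<psi> (p \<otimes>\<^bsub>P\<^esub> p') = \<psi> p \<otimes>\<^bsub>P\<^esub> \<psi> p'"
    and "r \<in> carrier R \<Longrightarrow> p \<in> carrier P \<Longrightarrow> \<psi> (lact P r p) = lact P (act R g r) (\<psi> p)"
    and "\<psi> \<in> hom P P"
  using assms by (auto simp: semilinear_def hom_def)

lemma semilinear_iff_lHom: "restrict \<psi> (carrier P) \<in> carrier (lHom R P (ltwist R g P)) \<longleftrightarrow> semilinear \<psi>"
  by (auto simp: lHom_def semilinear_def hom_def M.lact_closed Pi_iff)

text \<open>At \<open>\<Sum> d\<^sub>i \<otimes> p\<^sub>i\<close> this is the class of \<open>\<Sum> \<epsilon>(\<psi>(p\<^sub>i) \<otimes> d\<^sub>i)\<close>; both traces are its value at the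
  coevaluation. It is balanced over \<open>R\<close> because \<open>\<epsilon>(\<psi>(r p) \<otimes> d) = g(r) \<epsilon>(\<psi>(p) \<otimes> d)\<close> is identified with
  \<open>\<epsilon>(\<psi>(p) \<otimes> d) r = \<epsilon>(\<psi>(p) \<otimes> d r)\<close> in the twisted quotient.\<close>

definition dual_trace :: "('p \<Rightarrow> 'p) \<Rightarrow> ('d, 'p) tens \<Rightarrow> 'r set" where
  "dual_trace \<psi> = tensor_lift (twisted_HH0 R g (unit_bimod R)) (\<lambda>d p. twisted_class (ev (\<psi> p) d))"

lemma dual_trace:
  assumes \<psi>: "semilinear \<psi>"
  shows dual_trace_hom: "dual_trace \<psi> \<in> hom (tensor R D P) (twisted_HH0 R g (unit_bimod R))"
    and dual_trace_pure: "d \<in> carrier D \<Longrightarrow> p \<in> carrier P \<Longrightarrow>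
      dual_trace \<psi> (pure_tensor R D P d p) = twisted_class (ev (\<psi> p) d)"
proof -
  have "balanced R D P (twisted_HH0 R g (unit_bimod R)) (\<lambda>d p. twisted_class (ev (\<psi> p) d))"
    by (intro balancedI)
      (simp_all add: semilinearD [OF \<psi>] ev twisted_class g)
  from DP.tensor_lift [OF comm_group_twisted_HH0 this]
  show "dual_trace \<psi> \<in> hom (tensor R D P) (twisted_HH0 R g (unit_bimod R))"
    and "d \<in> carrier D \<Longrightarrow> p \<in> carrier P \<Longrightarrow>
      dual_trace \<psi> (pure_tensor R D P d p) = twisted_class (ev (\<psi> p) d)"
    unfolding dual_trace_def by simp_all
qed

text \<open>The composite of the maps after \<open>\<eta>\<close> is a homomorphism on \<open>D \<odot> P\<close> once it is precomposed with the
  class map, and it sends \<open>d \<otimes> p\<close> to the class of \<open>\<epsilon>(\<phi>\<^sub>g(f(p)) \<otimes> d)\<close>.\<close>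

lemma twisted_trace_class:
  assumes f: "f \<in> bimod_hom R S P P" and s: "s \<in> carrier S"
  shows "twisted_trace G R S P \<tau> D \<eta> \<epsilon> g f (twisted_HH0_class S g (unit_bimod S) s) =
    dual_trace (\<phi> g \<circ> f) (\<eta> s)"
proof -
  let ?f = "tensor_map R D P (\<lambda>d. d) f"
  note b = S.bimodule_ltwist [OF _ g] and h = S.bimod_hom_ltwist [OF _ g]
  note DPb = b [OF DP.bimodule_tensor]
  note PDb = R.bimodule_ltwist [OF PD.bimodule_tensor g]
  note m = tensor_map_bimod_hom [OF DP.tensor_pair_axioms DP.tensor_pair_axioms id_bimod_hom f]
  note e = R.bimod_hom_ltwist [OF eps g]
  let ?c = "twisted_HH0_class S g (tensor R D P)"
  let ?h = "\<lambda>x. twisted_HH0_map R g (unit_bimod R) \<epsilon> (twisted_cyc G S R g D P \<tau> (?c (?f x)))"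
  have es: "\<eta> s \<in> carrier (tensor R D P)"
    using bimod_homD(2) [OF eta] s by simp
  have 1: "twisted_HH0_map S g (tensor R D P) \<eta> (twisted_HH0_class S g (unit_bimod S) s) = ?c (\<eta> s)"
    using HH0_map_class [OF b [OF S.R.bimodule_unit_bimod] DPb h [OF eta], of s] s by simp
  have 2: "twisted_HH0_map S g (tensor R D P) ?f (?c (\<eta> s)) = ?c (?f (\<eta> s))"
    using HH0_map_class [OF DPb DPb h [OF m(1)], of "\<eta> s"] es by simp
  have c: "?c \<in> hom (tensor R D P) (twisted_HH0 S g (tensor R D P))"
    using HH0_class_hom [OF DPb] by (simp add: hom_def)
  have hom: "?h \<in> hom (tensor R D P) (twisted_HH0 R g (unit_bimod R))"
    using Group.hom_compose [OF Group.hom_compose [OF Group.hom_compose [OF bimod_homD(1) [OF m(1)] c]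
      twisted_cyc_hom [OF D.bimodule_axioms g]] HH0_map_hom [OF PDb bimodule_twisted_unit e]]
    by (simp add: comp_def)
  have sl: "semilinear (\<phi> g \<circ> f)"
    using bimod_homD [OF f] by (auto simp: semilinear_def hom_def action_equivariant g)
  have gA: "group (twisted_HH0 R g (unit_bimod R))"
    using comm_group_twisted_HH0 by (simp add: comm_group_def)
  have "?h (\<eta> s) = dual_trace (\<phi> g \<circ> f) (\<eta> s)"
    by (rule DP.hom_ext [OF gA hom dual_trace_hom [OF sl] _ es])
      (simp add: dual_trace_pure [OF sl] m(2) bimod_homD(2) [OF f] g action_closed
        twisted_cyc_class_pure [OF D.bimodule_axioms] HH0_map_class [OF PDb bimodule_twisted_unit e] PD.pure_closed)
  then show ?thesis
    by (simp add: twisted_trace_def 1 2)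
qed

end


section \<open>The twisted Hattori--Stallings trace\<close>

context twisted_dual_pair
begin

lemma bimodule_ldual: "bimodule S R (ldual R P)"
  by (rule bimodule_lHom [OF M.bimodule_axioms R.R.bimodule_unit_bimod])

lemma bimodule_gP: "bimodule R S (ltwist R g P)"
  by (rule R.bimodule_ltwist [OF M.bimodule_axioms g])

sublocale dual: bimodule S R "ldual R P"
  by (rule bimodule_ldual)

sublocale HS: tensor_pair S R S "ldual R P" "ltwist R g P"
  by (intro tensor_pair.intro bimodule_ldual bimodule_gP)

abbreviation HomP :: "('s, 's, 'p \<Rightarrow> 'p) bimod" where
  "HomP \<equiv> lHom R P (ltwist R g P)"

lemma comm_group_HomP: "comm_group HomP"
  using bimodule_lHom [OF M.bimodule_axioms bimodule_gP] by (rule bimodule.axioms(3))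

lemma HS_delta:
  shows HS_delta_hom: "HS_delta R P g \<in> hom (tensor R (ldual R P) (ltwist R g P)) HomP"
    and HS_delta_pure: "\<xi> \<in> carrier (ldual R P) \<Longrightarrow> p \<in> carrier P \<Longrightarrow>
      HS_delta R P g (pure_tensor R (ldual R P) (ltwist R g P) \<xi> p) =
        (\<lambda>x \<in> carrier P. lact P (act R g (\<xi> x)) p)"
proof -
  note [simp] = lHomD(1) [of _ R P "unit_bimod R", simplified] lHomD(2,3) [of _ R P "unit_bimod R"]
  have "balanced R (ldual R P) (ltwist R g P) HomP
      (\<lambda>\<xi> p. \<lambda>x \<in> carrier P. lact (ltwist R g P) (\<xi> x) p)"
    using g by (intro balancedI) (auto intro!: lHomI restrict_ext
        simp: M.bimodule_simps R.act_add R.act_mult M.M.m_ac)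
  from HS.tensor_lift [OF comm_group_HomP this]
  show "HS_delta R P g \<in> hom (tensor R (ldual R P) (ltwist R g P)) HomP"
    and "\<xi> \<in> carrier (ldual R P) \<Longrightarrow> p \<in> carrier P \<Longrightarrow>
      HS_delta R P g (pure_tensor R (ldual R P) (ltwist R g P) \<xi> p) =
        (\<lambda>x \<in> carrier P. lact P (act R g (\<xi> x)) p)"
    unfolding HS_delta_def by simp_all
qed

text \<open>The class of \<open>\<xi>(p)\<close> is balanced because \<open>\<xi>(p) r\<close> and \<open>\<xi>(g(r) p) = g(r) \<xi>(p)\<close> have the same class.\<close>

lemma HS_pi:
  shows HS_pi_hom: "HS_pi R g \<in> hom (tensor R (ldual R P) (ltwist R g P)) (twisted_HH0 R g (unit_bimod R))"
    and HS_pi_pure: "\<xi> \<in> carrier (ldual R P) \<Longrightarrow> p \<in> carrier P \<Longrightarrow>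
      HS_pi R g (pure_tensor R (ldual R P) (ltwist R g P) \<xi> p) = twisted_class (\<xi> p)"
proof -
  note [simp] = lHomD(1) [of _ R P "unit_bimod R", simplified] lHomD(2,3) [of _ R P "unit_bimod R"]
  have "balanced R (ldual R P) (ltwist R g P) (twisted_HH0 R g (unit_bimod R)) (\<lambda>\<xi> p. twisted_class (\<xi> p))"
    using g by (intro balancedI) (simp_all add: twisted_class)
  from HS.tensor_lift [OF comm_group_twisted_HH0 this]
  show "HS_pi R g \<in> hom (tensor R (ldual R P) (ltwist R g P)) (twisted_HH0 R g (unit_bimod R))"
    and "\<xi> \<in> carrier (ldual R P) \<Longrightarrow> p \<in> carrier P \<Longrightarrow>
      HS_pi R g (pure_tensor R (ldual R P) (ltwist R g P) \<xi> p) = twisted_class (\<xi> p)"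
    unfolding HS_pi_def by simp_all
qed

text \<open>The homomorphism \<open>\<Sum> d\<^sub>i \<otimes> p\<^sub>i \<mapsto> \<Sum> \<epsilon>(- \<otimes> d\<^sub>i) \<otimes> \<psi>(p\<^sub>i)\<close>. Its value at the coevaluation is the preimage of
  \<open>\<psi>\<close> under \<open>\<delta>\<close>.\<close>

definition delta_lift :: "('p \<Rightarrow> 'p) \<Rightarrow> ('d, 'p) tens \<Rightarrow> ('p \<Rightarrow> 'r, 'p) tens" where
  "delta_lift \<psi> = tensor_lift (tensor R (ldual R P) (ltwist R g P))
     (\<lambda>d p. pure_tensor R (ldual R P) (ltwist R g P) (ev_hom d) (\<psi> p))"

lemma delta_lift:
  assumes \<psi>: "semilinear \<psi>"
  shows delta_lift_hom: "delta_lift \<psi> \<in> hom (tensor R D P) (tensor R (ldual R P) (ltwist R g P))"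
    and delta_lift_pure: "d \<in> carrier D \<Longrightarrow> p \<in> carrier P \<Longrightarrow>
      delta_lift \<psi> (pure_tensor R D P d p) =
        pure_tensor R (ldual R P) (ltwist R g P) (ev_hom d) (\<psi> p)"
proof -
  have "balanced R D P (tensor R (ldual R P) (ltwist R g P))
      (\<lambda>d p. pure_tensor R (ldual R P) (ltwist R g P) (ev_hom d) (\<psi> p))"
    using HS.pure_closed HS.pure_add_left HS.pure_add_right HS.pure_balanced
    by (intro balancedI)
      (simp_all add: semilinearD [OF \<psi>] ev_hom_closed ev_hom_add ev_hom_ract del: lHom_simps)
  from DP.tensor_lift [OF HS.comm_group_tensor this]
  show "delta_lift \<psi> \<in> hom (tensor R D P) (tensor R (ldual R P) (ltwist R g P))"
    and "d \<in> carrier D \<Longrightarrow> p \<in> carrier P \<Longrightarrow>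
      delta_lift \<psi> (pure_tensor R D P d p) =
        pure_tensor R (ldual R P) (ltwist R g P) (ev_hom d) (\<psi> p)"
    unfolding delta_lift_def by simp_all
qed

text \<open>At \<open>y\<close> the left-hand side is \<open>\<Sum> g(\<epsilon>(y \<otimes> d\<^sub>i)) \<psi>(p\<^sub>i) = \<psi>(\<Sum> \<epsilon>(y \<otimes> d\<^sub>i) p\<^sub>i)\<close>, which is \<open>\<psi>(y)\<close> by the triangle
  identity.\<close>

lemma HS_delta_delta_lift:
  assumes \<psi>: "semilinear \<psi>"
  shows "HS_delta R P g (delta_lift \<psi> coev) = restrict \<psi> (carrier P)"
proof (rule lHom_eqI)
  show "HS_delta R P g (delta_lift \<psi> coev) \<in> carrier HomP"
    by (rule hom_in_carrier [OF HS_delta_hom hom_in_carrier [OF delta_lift_hom [OF \<psi>] coev_closed]])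
  show "restrict \<psi> (carrier P) \<in> carrier HomP"
    using \<psi> by (simp add: semilinear_iff_lHom)
  fix y assume y: "y \<in> carrier P"
  have evy: "(\<lambda>\<chi>. \<chi> y) \<in> hom HomP P"
    using y by (auto simp: hom_def dest: lHomD(1))
  have "HS_delta R P g (delta_lift \<psi> coev) y = \<psi> (contract y coev)"
    using Group.hom_compose [OF Group.hom_compose [OF delta_lift_hom [OF \<psi>] HS_delta_hom] evy]
      Group.hom_compose [OF contract_hom [OF y] semilinearD(4) [OF \<psi>]]
    by - (rule DP.hom_ext [OF M.M.is_group _ _ _ coev_closed], simp_all add: comp_def
      delta_lift_pure [OF \<psi>] HS_delta_pure ev_hom_closed semilinearD [OF \<psi>] contract_pure y
      ev_closed, simp add: ev_hom_def y)
  then show "HS_delta R P g (delta_lift \<psi> coev) y = restrict \<psi> (carrier P) y"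
    using y by (simp add: contract_coev)
qed

text \<open>The homomorphism \<open>\<Sum> d\<^sub>i \<otimes> p\<^sub>i \<mapsto> \<Sum> \<epsilon>(- \<otimes> d\<^sub>i) \<xi>(p\<^sub>i)\<close>. At the coevaluation it returns \<open>\<xi>\<close>, since \<open>\<xi>\<close> is
  determined by its values on the dual basis.\<close>

definition dual_expansion :: "('p \<Rightarrow> 'r) \<Rightarrow> ('d, 'p) tens \<Rightarrow> 'p \<Rightarrow> 'r" where
  "dual_expansion \<xi> = tensor_lift (ldual R P) (\<lambda>d p. ract (ldual R P) (ev_hom d) (\<xi> p))"

lemma
  assumes \<xi>: "\<xi> \<in> carrier (ldual R P)"
  shows dual_expansion_hom: "dual_expansion \<xi> \<in> hom (tensor R D P) (ldual R P)"
    and dual_expansion_pure: "d \<in> carrier D \<Longrightarrow> p \<in> carrier P \<Longrightarrow>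
      dual_expansion \<xi> (pure_tensor R D P d p) = ract (ldual R P) (ev_hom d) (\<xi> p)"
    and dual_expansion_coev: "dual_expansion \<xi> coev = \<xi>"
proof -
  note xi = lHomD(1) [OF \<xi>, simplified] lHomD(2,3) [OF \<xi>, simplified]
  have b: "balanced R D P (ldual R P) (\<lambda>d p. ract (ldual R P) (ev_hom d) (\<xi> p))"
    by (intro balancedI)
      (simp_all add: xi ev_hom_closed ev_hom_add ev_hom_ract dual.bimodule_simps del: lHom_simps)
  note lift = DP.tensor_lift [OF dual.M.comm_group_axioms b]
  show F: "dual_expansion \<xi> \<in> hom (tensor R D P) (ldual R P)"
    unfolding dual_expansion_def by (rule lift(1))
  show pure: "dual_expansion \<xi> (pure_tensor R D P d p) = ract (ldual R P) (ev_hom d) (\<xi> p)"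
    if "d \<in> carrier D" "p \<in> carrier P" for d p
    unfolding dual_expansion_def using that by (rule lift(2))
  show "dual_expansion \<xi> coev = \<xi>"
  proof (rule lHom_eqI)
    show "dual_expansion \<xi> coev \<in> carrier (ldual R P)" "\<xi> \<in> carrier (ldual R P)"
      by (rule hom_in_carrier [OF F coev_closed], rule \<xi>)
    fix y assume y: "y \<in> carrier P"
    have evy: "(\<lambda>\<chi>. \<chi> y) \<in> hom (ldual R P) (unit_bimod R)"
      using y by (auto simp: hom_def dest: lHomD(1))
    have xi_hom: "\<xi> \<in> hom P (unit_bimod R)"
      using xi by (simp add: hom_def)
    have gU: "group (unit_bimod R)"
      using R.R.comm_group_unit_bimod by (simp add: comm_group_def)
    have "dual_expansion \<xi> coev y = \<xi> (contract y coev)"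
      using Group.hom_compose [OF F evy] Group.hom_compose [OF contract_hom [OF y] xi_hom]
      by - (rule DP.hom_ext [OF gU _ _ _ coev_closed], simp_all add: comp_def pure contract_pure
        y xi ev_closed ev_hom_def)
    then show "dual_expansion \<xi> coev y = \<xi> y"
      by (simp add: contract_coev y)
  qed
qed

text \<open>With the preceding expansion, moving the scalars \<open>\<xi>(p\<^sub>i)\<close> across the tensor product gives
  \<open>\<xi> \<otimes> q = \<Sum> \<epsilon>(- \<otimes> d\<^sub>i) \<otimes> g(\<xi>(p\<^sub>i)) q = \<Sum> \<epsilon>(- \<otimes> d\<^sub>i) \<otimes> \<delta>(\<xi> \<otimes> q)(p\<^sub>i)\<close>. So \<open>\<delta>\<close> is injective.\<close>

lemma delta_lift_HS_delta:
  assumes t: "t \<in> carrier (tensor R (ldual R P) (ltwist R g P))"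
  shows "delta_lift (HS_delta R P g t) coev = t"
proof -
  let ?T = "tensor R (ldual R P) (ltwist R g P)"
  have sl: "semilinear (HS_delta R P g t)" if "t \<in> carrier ?T" for t
    using hom_in_carrier [OF HS_delta_hom that] extensional_restrict [OF lHomD(4)]
    by (metis semilinear_iff_lHom)
  have hom: "(\<lambda>t. delta_lift (HS_delta R P g t) coev) \<in> hom ?T ?T"
  proof (rule homI)
    fix t assume "t \<in> carrier ?T"
    then show "delta_lift (HS_delta R P g t) coev \<in> carrier ?T"
      by (intro hom_in_carrier [OF delta_lift_hom coev_closed] sl)
  next
    fix t u assume t: "t \<in> carrier ?T" and u: "u \<in> carrier ?T"
    have tu: "t \<otimes>\<^bsub>?T\<^esub> u \<in> carrier ?T"
      using t u by simp
    show "delta_lift (HS_delta R P g (t \<otimes>\<^bsub>?T\<^esub> u)) coev =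
        delta_lift (HS_delta R P g t) coev \<otimes>\<^bsub>?T\<^esub> delta_lift (HS_delta R P g u) coev"
      by (rule DP.hom_ext [OF HS.MN.is_group delta_lift_hom [OF sl [OF tu]]
            HS.MN.hom_pointwise_mult [OF delta_lift_hom [OF sl [OF t]] delta_lift_hom [OF sl [OF u]]]
            _ coev_closed])
        (use semilinearD(1) [OF sl [OF t]] semilinearD(1) [OF sl [OF u]] HS.pure_add_right in
          \<open>simp add: delta_lift_pure sl t u tu,
            simp add: hom_mult [OF HS_delta_hom t u] ev_hom_closed\<close>)
  qed
  have "delta_lift (HS_delta R P g (pure_tensor R (ldual R P) (ltwist R g P) \<xi> q)) coev =
      pure_tensor R (ldual R P) (ltwist R g P) \<xi> q"
    if \<xi>: "\<xi> \<in> carrier (ldual R P)" and q: "q \<in> carrier P" for \<xi> q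
  proof -
    let ?u = "pure_tensor R (ldual R P) (ltwist R g P) \<xi> q"
    have u: "?u \<in> carrier ?T"
      using HS.pure_closed \<xi> q by simp
    have p: "(\<lambda>\<zeta>. pure_tensor R (ldual R P) (ltwist R g P) \<zeta> q) \<in> hom (ldual R P) ?T"
      using HS.pure_closed HS.pure_add_left q by (simp add: hom_def)
    have pure: "delta_lift (HS_delta R P g ?u) (pure_tensor R D P d p) =
        pure_tensor R (ldual R P) (ltwist R g P) (dual_expansion \<xi> (pure_tensor R D P d p)) q"
      if d: "d \<in> carrier D" and p: "p \<in> carrier P" for d p
    proof -
      have "\<xi> p \<in> carrier R"
        using lHomD(1) [OF \<xi> p] by simp
      moreover have "HS_delta R P g ?u p = lact P (act R g (\<xi> p)) q"
        using p q \<xi> by (simp add: HS_delta_pure)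
      ultimately show ?thesis
        using HS.pure_balanced [OF ev_hom_closed [OF d], of "\<xi> p" q] d p q \<xi>
        by (simp only: delta_lift_pure [OF sl [OF u]] dual_expansion_pure) simp
    qed
    have "delta_lift (HS_delta R P g ?u) coev = pure_tensor R (ldual R P) (ltwist R g P) (dual_expansion \<xi> coev) q"
      by (rule DP.hom_ext [OF HS.MN.is_group delta_lift_hom [OF sl [OF u]]
        Group.hom_compose [OF dual_expansion_hom [OF \<xi>] p, unfolded comp_def] pure coev_closed])
    then show ?thesis
      by (simp add: dual_expansion_coev [OF \<xi>])
  qed
  then show ?thesis
    using hom HS.id_hom_tensor
    by - (rule HS.hom_ext [OF HS.MN.is_group _ _ _ t], simp_all)
qed

lemma HS_trace_eq_dual_trace:
  assumes \<psi>: "semilinear \<psi>"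
  shows "HS_trace R P g \<psi> = dual_trace \<psi> coev"
proof -
  let ?T = "tensor R (ldual R P) (ltwist R g P)"
  have closed: "delta_lift \<psi> coev \<in> carrier ?T"
    by (rule hom_in_carrier [OF delta_lift_hom [OF \<psi>] coev_closed])
  have "inj_on (HS_delta R P g) (carrier ?T)"
    by (rule inj_on_inverseI [where g = "\<lambda>\<chi>. delta_lift \<chi> coev"]) (rule delta_lift_HS_delta)
  then have "inv_into (carrier ?T) (HS_delta R P g) (restrict \<psi> (carrier P)) = delta_lift \<psi> coev"
    using closed HS_delta_delta_lift [OF \<psi>] by (intro inv_into_f_eq)
  then have "HS_trace R P g \<psi> = HS_pi R g (delta_lift \<psi> coev)"
    by (simp add: HS_trace_def)
  also have "\<dots> = dual_trace \<psi> coev"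
    using Group.hom_compose [OF delta_lift_hom [OF \<psi>] HS_pi_hom] dual_trace_hom [OF \<psi>]
      comm_group_twisted_HH0
    by - (rule DP.hom_ext [OF _ _ _ _ coev_closed], simp_all add: comm_group_def comp_def
      delta_lift_pure [OF \<psi>] HS_pi_pure ev_hom_closed semilinearD [OF \<psi>] dual_trace_pure [OF \<psi>],
      simp add: ev_hom_def semilinearD [OF \<psi>])
  finally show ?thesis .
qed

lemma HS_trace_cong:
  assumes "\<And>p. p \<in> carrier P \<Longrightarrow> \<psi>' p = \<psi> p"
  shows "HS_trace R P g \<psi>' = HS_trace R P g \<psi>"
proof -
  have "restrict \<psi>' (carrier P) = restrict \<psi> (carrier P)"
    using assms by (rule restrict_ext)
  then show ?thesis
    by (simp add: HS_trace_def)
qed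

text \<open>Since \<open>\<eta>(s) = \<eta>(1) s\<close>, right multiplication by \<open>s\<close> can be moved from the coevaluation into the
  endomorphism.\<close>

lemma twisted_trace_eq_HS_trace:
  assumes f: "f \<in> bimod_hom R S P P" and s: "s \<in> carrier S"
  defines "\<psi> \<equiv> \<lambda>p. \<phi> g (f (ract P p s))"
  shows "twisted_trace G R S P \<tau> D \<eta> \<epsilon> g f (twisted_HH0_class S g (unit_bimod S) s) = HS_trace R P g \<psi>"
    and "HS_trace R P g \<psi> \<in> carrier (twisted_HH0 R g (unit_bimod R))"
proof -
  have \<psi>: "semilinear \<psi>" and f': "semilinear (\<phi> g \<circ> f)"
    using bimod_homD [OF f] s
    by (auto simp: \<psi>_def semilinear_def hom_def action_equivariant g M.bimodule_simps)
  have gA: "group (twisted_HH0 R g (unit_bimod R))"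
    using comm_group_twisted_HH0 by (simp add: comm_group_def)
  have "dual_trace (\<phi> g \<circ> f) (ract (tensor R D P) coev s) = dual_trace \<psi> coev"
    using Group.hom_compose [OF DP.ract_tensor_hom [OF s] dual_trace_hom [OF f']] dual_trace_hom [OF \<psi>]
    by - (rule DP.hom_ext [OF gA _ _ _ coev_closed], simp_all add: comp_def dual_trace_pure [OF \<psi>]
      dual_trace_pure [OF f', unfolded comp_def] DP.ract_pure s M.ract_closed, simp add: \<psi>_def)
  then show "twisted_trace G R S P \<tau> D \<eta> \<epsilon> g f (twisted_HH0_class S g (unit_bimod S) s) = HS_trace R P g \<psi>"
    by (simp add: twisted_trace_class [OF f s] coev_ract [OF s] HS_trace_eq_dual_trace [OF \<psi>])
  show "HS_trace R P g \<psi> \<in> carrier (twisted_HH0 R g (unit_bimod R))"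
    unfolding HS_trace_eq_dual_trace [OF \<psi>] by (rule hom_in_carrier [OF dual_trace_hom [OF \<psi>] coev_closed])
qed

end

theorem theorem1p3:
  fixes G :: "('g, 'y) monoid_scheme" and g :: 'g
    and R :: "('g, 'r) gring" and S :: "('g, 's) gring"
    and P :: "('r, 's, 'p) bimod" and \<tau> :: "('g, 'r, 's, 'p) twist"
    and D :: "('s, 'r, 'd) bimod" and \<sigma> :: "('g, 's, 'r, 'd) twist"
    and \<eta> :: "'s \<Rightarrow> ('d, 'p) tens" and \<epsilon> :: "('p, 'd) tens \<Rightarrow> 'r"
    and f :: "'p \<Rightarrow> 'p" and s :: 's
  assumes "group G" and "g \<in> carrier G"
    and "G_ring G R" and "G_ring G S"
    and "twist_1cell G R S P \<tau>"
    and "left_dual G R S P \<tau> D \<sigma> \<eta> \<epsilon>"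
    and "twist_2cell G R S P \<tau> P \<tau> f"
    and "s \<in> carrier S"
  shows "twisted_trace G R S P \<tau> D \<eta> \<epsilon> g f (twisted_HH0_class S g (unit_bimod S) s)
           = HS_trace_twist G R S P \<tau> g (f \<circ> (\<lambda>p. ract P p s)) \<and>
         HS_trace_twist G R S P \<tau> g (f \<circ> (\<lambda>p. ract P p s))
           = HS_trace_twist G R S P \<tau> g ((\<lambda>p. ract P p s) \<circ> f) \<and>
         HS_trace_twist G R S P \<tau> g ((\<lambda>p. ract P p s) \<circ> f)
           \<in> carrier (twisted_HH0 R g (unit_bimod R))"
proof -
  have P: "bimodule R S P"
    using assms(5) by (simp add: twist_1cell_def)
  interpret twisted_dual_pair G R S P \<tau> D \<eta> \<epsilon> g
    using assms(2-6) P
    by (simp add: twisted_dual_pair_def twisted_dual_pair_axioms_def twisted_bimodule_def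
        twisted_bimodule_axioms_def left_dual_def twist_1cell_def twist_2cell_def)
  have f: "f \<in> bimod_hom R S P P"
    using assms(7) by (simp add: twist_2cell_def)
  have 1: "HS_trace_twist G R S P \<tau> g (f \<circ> (\<lambda>p. ract P p s)) = HS_trace R P g (\<lambda>p. \<phi> g (f (ract P p s)))"
    unfolding HS_trace_twist_def
    using assms(8) by (intro HS_trace_cong) (simp add: bitwist_eq_action g bimod_homD(2) [OF f] M.ract_closed)
  have 2: "HS_trace_twist G R S P \<tau> g ((\<lambda>p. ract P p s) \<circ> f) = HS_trace R P g (\<lambda>p. \<phi> g (f (ract P p s)))"
    unfolding HS_trace_twist_def
    using assms(8) by (intro HS_trace_cong)
      (simp add: bitwist_eq_action g bimod_homD(2,5) [OF f] M.ract_closed)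
  show ?thesis
    using twisted_trace_eq_HS_trace [OF f assms(8)] by (simp add: 1 2)
qed

end
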